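(* There exist real numbers $a<b$, a differentiable function $G\colon[a,b]\to\mathbb{R}$ and a point $x_0\in(a,b)$ such that the derivative $g=G'$ is Riemann integrable on $[a,b]$, $x_0$ is an isolated local extremum of $g$, and $x_0$ is not an inflection point of $G$.
   Context: A point $x_0$ is a local maximum (minimum) of $g$ if $g(x)\le g(x_0)$ (resp. $g(x)\ge g(x_0)$) for all $x$ in some neighbourhood of $x_0$ (intersected with the domain); a local extremum is a local maximum or a local minimum. A local extremum $x_0$ of $g$ is isolated if some neighbourhood of $x_0$ contains no other point of local extremum of $g$. A point $x_0\in(a,b)$ is an inflection point of $G$ if there is $\varepsilon>0$ such that $G$ is strictly convex on one of the one-sided neighbourhoods $(x_0-\varepsilon,x_0]$, $[x_0,x_0+\varepsilon)$ and strictly concave on the other. At the endpoints of $[a,b]$ derivatives are one-sided. *)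

theory Defs
  imports "HOL-Analysis.Analysis"
begin

text \<open>
  Functions on \<open>[a, b]\<close> are represented by total functions \<open>real \<Rightarrow> real\<close>; every notion below takes
  the domain as a parameter and depends only on the values of the function there.
\<close>

definition local_max_on :: "real set \<Rightarrow> (real \<Rightarrow> real) \<Rightarrow> real \<Rightarrow> bool" where
  "local_max_on S g x0 \<longleftrightarrow>
     x0 \<in> S \<and> (\<exists>U. open U \<and> x0 \<in> U \<and> (\<forall>x\<in>U \<inter> S. g x \<le> g x0))"

definition local_min_on :: "real set \<Rightarrow> (real \<Rightarrow> real) \<Rightarrow> real \<Rightarrow> bool" where
  "local_min_on S g x0 \<longleftrightarrow>
     x0 \<in> S \<and> (\<exists>U. open U \<and> x0 \<in> U \<and> (\<forall>x\<in>U \<inter> S. g x \<ge> g x0))"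

definition local_extremum_on :: "real set \<Rightarrow> (real \<Rightarrow> real) \<Rightarrow> real \<Rightarrow> bool" where
  "local_extremum_on S g x0 \<longleftrightarrow> local_max_on S g x0 \<or> local_min_on S g x0"

definition isolated_local_extremum_on :: "real set \<Rightarrow> (real \<Rightarrow> real) \<Rightarrow> real \<Rightarrow> bool" where
  "isolated_local_extremum_on S g x0 \<longleftrightarrow>
     local_extremum_on S g x0 \<and>
     (\<exists>U. open U \<and> x0 \<in> U \<and> (\<forall>x\<in>U. local_extremum_on S g x \<longrightarrow> x = x0))"

definition strictly_convex_on :: "real set \<Rightarrow> (real \<Rightarrow> real) \<Rightarrow> bool" where
  "strictly_convex_on S f \<longleftrightarrow> convex S \<and>
     (\<forall>x\<in>S. \<forall>y\<in>S. \<forall>u>0. \<forall>v>0. x \<noteq> y \<and> u + v = 1 \<longrightarrow>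
        f (u * x + v * y) < u * f x + v * f y)"

definition strictly_concave_on :: "real set \<Rightarrow> (real \<Rightarrow> real) \<Rightarrow> bool" where
  "strictly_concave_on S f \<longleftrightarrow> strictly_convex_on S (\<lambda>x. - f x)"

definition inflection_point_on :: "real set \<Rightarrow> (real \<Rightarrow> real) \<Rightarrow> real \<Rightarrow> bool" where
  "inflection_point_on S G x0 \<longleftrightarrow>
     (\<exists>\<epsilon>>0. {x0 - \<epsilon><..<x0 + \<epsilon>} \<subseteq> S \<and>
        (strictly_convex_on {x0 - \<epsilon><..x0} G \<and> strictly_concave_on {x0..<x0 + \<epsilon>} G \<or>
         strictly_concave_on {x0 - \<epsilon><..x0} G \<and> strictly_convex_on {x0..<x0 + \<epsilon>} G))"

text \<open>
  The library's \<open>integrable_on\<close> is Henstock-Kurzweil integrability, which every derivative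
  satisfies. Riemann integrability requires the gauge in \<open>has_integral_real\<close> to be uniform:
  the Riemann sums converge as the mesh of the tagged division tends to \<open>0\<close>.
\<close>

definition riemann_integrable_on :: "(real \<Rightarrow> real) \<Rightarrow> real \<Rightarrow> real \<Rightarrow> bool" where
  "riemann_integrable_on f a b \<longleftrightarrow>
     (\<exists>I. \<forall>e>0. \<exists>\<delta>>0. \<forall>\<D>.
        \<D> tagged_division_of {a..b} \<and> (\<forall>(x, K)\<in>\<D>. measure lborel K < \<delta>) \<longrightarrow>
        \<bar>(\<Sum>(x, K)\<in>\<D>. measure lborel K * f x) - I\<bar> < e)"

end

theory Submission
  imports Defs
begin

text \<open>
  A continuous derivative without local extrema is monotone, so the example has to be discontinuous.
  Its building block is a derivative \<open>Z\<close>, supported in \<open>(0, 1)\<close>, without any local extremum in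
  \<open>(0, 1)\<close>. On each cell \<open>[1 / (k + 2), 1 / (k + 1)]\<close> it is a wave whose crest and trough are flat, with
  a small copy of \<open>Z\<close> itself placed on each flat piece, and its amplitude tends to \<open>1\<close> as
  \<open>k \<rightarrow> \<infinity>\<close>. Its values approach \<open>\<plusminus>1\<close> near \<open>0\<close> without attaining them, so no point is an extremum
  of \<open>Z\<close> on all of \<open>(0, 1)\<close>. A local extremum in \<open>(0, 1)\<close> can only sit inside a flat piece; enlarging that
  piece gives a local extremum of \<open>Z\<close> on a neighbourhood at least twice as long, and repeating this
  leads to a contradiction.

  Now take \<open>g x = - x\<close> for \<open>x \<le> 0\<close>, and for \<open>x > 0\<close> deform the identity on each cell to a step
  carrying a small copy of \<open>Z\<close>. Then \<open>0\<close> is a minimum of \<open>g\<close> and no nearby point is an extremum, but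
  \<open>g\<close> is not monotone on any interval \<open>[0, \<epsilon>)\<close>. All functions in the construction have countably many
  discontinuities. Riemann sums are integrals of step functions, so dominated convergence gives Riemann
  integrability.
\<close>

section \<open>Cells accumulating at 0\<close>

text \<open>
  The increasing affine bijection of the cell \<open>[1 / (k + 2), 1 / (k + 1)]\<close> onto \<open>[0, 1]\<close>, and its inverse.
\<close>

definition cell_coord :: "nat \<Rightarrow> real \<Rightarrow> real" where
  "cell_coord k x = (real k + 1) * ((real k + 2) * x - 1)"

definition cell_point :: "nat \<Rightarrow> real \<Rightarrow> real" where
  "cell_point k z = (1 + z / (real k + 1)) / (real k + 2)"

text \<open>
  If every \<open>w k\<close> vanishes off \<open>(0, 1)\<close>, the terms with \<open>k \<ge> 1 / x\<close> are \<open>0\<close>; for \<open>x \<le> 0\<close> the sum is empty.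
\<close>

definition cells :: "(nat \<Rightarrow> real \<Rightarrow> real) \<Rightarrow> real \<Rightarrow> real" where
  "cells w x = (\<Sum>k<nat \<lceil>1 / x\<rceil>. w k (cell_coord k x))"

lemma cell_coord_point: "cell_coord k (cell_point k z) = z"
proof -
  have "real k + 1 \<noteq> 0" "real k + 2 \<noteq> 0" by linarith+
  then have "(real k + 2) * cell_point k z = 1 + z / (real k + 1)" by (simp add: cell_point_def)
  then show ?thesis using \<open>real k + 1 \<noteq> 0\<close> by (simp add: cell_coord_def)
qed

lemma cell_point_coord: "cell_point k (cell_coord k x) = x"
proof -
  have "real k + 1 \<noteq> 0" "real k + 2 \<noteq> 0" by linarith+
  then show ?thesis by (simp add: cell_coord_def cell_point_def)
qed

lemma cell_point_0: "cell_point k 0 = 1 / (real k + 2)"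
  by (simp add: cell_point_def)

lemma cell_point_1: "cell_point k 1 = 1 / (real k + 1)"
proof -
  have "1 + 1 / (real k + 1) = (real k + 2) / (real k + 1)" by (simp add: divide_simps)
  then show ?thesis by (simp add: cell_point_def)
qed

lemma cell_point_less_iff: "cell_point k z < cell_point k y \<longleftrightarrow> z < y"
  by (simp add: cell_point_def divide_less_cancel)

lemma cell_coord_ge_1: "x > 0 \<Longrightarrow> 1 \<le> (real k + 1) * x \<Longrightarrow> 1 \<le> cell_coord k x"
proof -
  assume "x > 0" "1 \<le> (real k + 1) * x"
  then have "(real k + 1) * x \<le> (real k + 1) * ((real k + 2) * x - 1)"
    by (intro mult_left_mono) (auto simp: algebra_simps)
  with \<open>1 \<le> (real k + 1) * x\<close> show ?thesis unfolding cell_coord_def by linarith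
qed

lemma cell_coord_le_0: "(real k + 2) * x \<le> 1 \<Longrightarrow> cell_coord k x \<le> 0"
  unfolding cell_coord_def by (intro mult_nonneg_nonpos) auto

lemma cells_nonpos: "x \<le> 0 \<Longrightarrow> cells w x = 0"
proof -
  assume "x \<le> 0"
  then have "1 / x \<le> 0" by (simp add: divide_nonneg_nonpos)
  then show ?thesis by (simp add: cells_def)
qed

text \<open>If \<open>k * x\<close> is at least 1, then \<open>x\<close> lies to the right of cell
  \<open>k\<close> and term \<open>k\<close> vanishes, so the exact truncation beyond
  \<open>1 / x\<close> is immaterial. One fixed \<open>N\<close> then serves for all
  \<open>x\<close> from \<open>1 / N\<close> on, which makes the sum locally finite on the positive
  axis.\<close>

lemma cells_eq_sum:
  assumes w: "\<And>k z. z \<notin> {0<..<1} \<Longrightarrow> w k z = 0" and x: "x > 0" and N: "1 \<le> real N * x"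
  shows "cells w x = (\<Sum>k<N. w k (cell_coord k x))"
proof -
  have z: "w k (cell_coord k x) = 0" if "1 \<le> real k * x" for k
  proof -
    have "1 \<le> cell_coord k x" using that x by (intro cell_coord_ge_1) (auto simp: algebra_simps)
    then show ?thesis using w by auto
  qed
  have M: "1 \<le> real (nat \<lceil>1 / x\<rceil>) * x"
  proof -
    have "1 / x \<le> real (nat \<lceil>1 / x\<rceil>)" by linarith
    then show ?thesis using x by (simp only: pos_divide_le_eq)
  qed
  have *: "(\<Sum>k<M. w k (cell_coord k x)) = (\<Sum>k<N. w k (cell_coord k x))"
    if "M \<le> N" "1 \<le> real M * x" for M N
  proof (rule sum.mono_neutral_left)
    show "\<forall>i\<in>{..<N} - {..<M}. w i (cell_coord i x) = 0"
    proof
      fix i assume "i \<in> {..<N} - {..<M}"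
      then have "real M * x \<le> real i * x" using x by (intro mult_right_mono) auto
      then show "w i (cell_coord i x) = 0" using that by (intro z) linarith
    qed
  qed (use that in auto)
  show ?thesis
  proof (cases "nat \<lceil>1 / x\<rceil> \<le> N")
    case True then show ?thesis unfolding cells_def using M by (rule *)
  next
    case False
    then have "N \<le> nat \<lceil>1 / x\<rceil>" by linarith
    from *[OF this N] show ?thesis unfolding cells_def by (rule sym)
  qed
qed

lemma cell_point_pos: "0 \<le> z \<Longrightarrow> 0 < cell_point k z"
proof -
  assume "0 \<le> z"
  then have "0 \<le> z / (real k + 1)" by (intro divide_nonneg_nonneg) auto
  then show ?thesis unfolding cell_point_def by (intro divide_pos_pos) linarith+
qed

text \<open>Cells of smaller index lie to the right of the point and those of larger index to its
  left, so their terms are 0. The end points shared by two cells cause no conflict because every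
  \<open>w k\<close> vanishes at 0 and 1.\<close>

lemma cells_point:
  assumes w: "\<And>k z. z \<notin> {0<..<1} \<Longrightarrow> w k z = 0" and z: "z \<in> {0..1}"
  shows "cells w (cell_point k z) = w k z"
proof -
  let ?x = "cell_point k z"
  have x: "?x > 0" using z cell_point_pos by simp
  have lo: "1 \<le> (real k + 2) * ?x" and hi: "(real k + 1) * ?x \<le> 1"
  proof -
    have k: "real k + 1 > 0" "real k + 2 > 0" by linarith+
    then have "(real k + 2) * ?x = 1 + z / (real k + 1)" by (simp add: cell_point_def)
    then show "1 \<le> (real k + 2) * ?x" using z by simp
    have "(real k + 1) * ?x = (real k + 1 + z) / (real k + 2)"
      using k by (simp add: cell_point_def distrib_left)
    then show "(real k + 1) * ?x \<le> 1" using z k by (simp add: divide_le_eq_1)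
  qed
  have "cells w ?x = (\<Sum>j<k+2. w j (cell_coord j ?x))"
    by (rule cells_eq_sum) (use w x lo in \<open>auto simp: algebra_simps\<close>)
  also have "\<dots> = (\<Sum>j<k+2. if j = k then w k z else 0)"
  proof (rule sum.cong)
    fix j assume "j \<in> {..<k+2}"
    consider "j = k" | "j < k" | "j > k" by linarith
    then show "w j (cell_coord j ?x) = (if j = k then w k z else 0)"
    proof cases
      case 2
      then have "(real j + 2) * ?x \<le> (real k + 1) * ?x" using x by (intro mult_right_mono) auto
      then have "cell_coord j ?x \<le> 0" using hi by (intro cell_coord_le_0) linarith
      with 2 w show ?thesis by auto
    next
      case 3
      then have "(real k + 2) * ?x \<le> (real j + 1) * ?x" using x by (intro mult_right_mono) auto
      then have "1 \<le> cell_coord j ?x" using lo x by (intro cell_coord_ge_1) linarith+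
      with 3 w show ?thesis by auto
    qed (simp add: cell_coord_point)
  qed simp
  also have "\<dots> = w k z" by simp
  finally show ?thesis .
qed

lemma cell_point_cases:
  assumes "0 < x" "x < 1"
  obtains k z where "0 < z" "z \<le> 1" "x = cell_point k z"
proof -
  define n where "n = nat \<lceil>1 / x\<rceil>"
  have "1 / x > 1" using assms by simp
  then have n2: "n \<ge> 2" unfolding n_def by linarith
  define k where "k = n - 2"
  have n: "real n = real k + 2" using n2 by (simp add: k_def)
  have "1 / x \<le> real n" "real n < 1 / x + 1" using \<open>1/x > 1\<close> unfolding n_def by linarith+
  then have 1: "1 \<le> (real k + 2) * x" and 2: "(real k + 1) * x < 1"
    using assms unfolding n by (simp_all add: field_simps)
  define z where "z = cell_coord k x"
  show ?thesis
  proof (cases "z = 0")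
    case False
    have "z \<ge> 0" unfolding z_def cell_coord_def using 1 by simp
    moreover have "z \<le> 1"
    proof -
      have "(real k + 2) * ((real k + 1) * x) \<le> (real k + 2) * 1"
        using 2 by (intro mult_left_mono) auto
      then show ?thesis unfolding z_def cell_coord_def by (simp add: algebra_simps)
    qed
    moreover have "x = cell_point k z" by (simp only: z_def cell_point_coord)
    ultimately show ?thesis using False that[of z k] by (metis less_le)
  next
    \<comment> \<open>The ceiling selects cells that are closed on the left; a left end is recounted
      as the right end of the next cell.\<close>
    case True
    have "x = cell_point k 0" unfolding True[symmetric] by (simp only: z_def cell_point_coord)
    also have "\<dots> = cell_point (Suc k) 1" by (simp add: cell_point_0 cell_point_1)
    finally show ?thesis by (intro that[of 1 "Suc k"]) auto
  qed
qed

lemma cell_point_less_1: "z < 1 \<Longrightarrow> cell_point k z < 1"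
proof -
  assume "z < 1"
  then have "cell_point k z < cell_point k 1" by (simp add: cell_point_less_iff)
  also have "cell_point k 1 \<le> 1" using cell_coord_ge_1[of 1 k] cell_point_less_iff[of k "cell_coord k 1" 1] by (simp add: cell_point_coord)
  finally show ?thesis .
qed

lemma cells_ge_1:
  assumes w: "\<And>k z. z \<notin> {0<..<1} \<Longrightarrow> w k z = 0" and x: "1 \<le> x"
  shows "cells w x = 0"
proof -
  have "cells w x = (\<Sum>k<1. w k (cell_coord k x))" by (rule cells_eq_sum) (use w x in auto)
  moreover have "1 \<le> cell_coord 0 x" using x by (intro cell_coord_ge_1) auto
  ultimately show ?thesis using w by simp
qed

lemma cells_outside:
  assumes w: "\<And>k z. z \<notin> {0<..<1} \<Longrightarrow> w k z = 0" and x: "x \<notin> {0<..<1}"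
  shows "cells w x = 0"
proof (cases "x \<le> 0")
  case True
  then show ?thesis by (rule cells_nonpos)
next
  case False
  with x have "1 \<le> x" by simp
  with w show ?thesis by (rule cells_ge_1)
qed

lemma cells_abs_le:
  assumes w: "\<And>k z. z \<notin> {0<..<1} \<Longrightarrow> w k z = 0" and B: "\<And>k z. \<bar>w k z\<bar> \<le> B"
  shows "\<bar>cells w x\<bar> \<le> B"
proof (cases "x \<in> {0<..<1}")
  case True
  then obtain k z where "0 < z" "z \<le> 1" "x = cell_point k z" by (auto elim: cell_point_cases)
  then show ?thesis using cells_point[where w=w and z=z and k=k] w B by simp
next
  case False
  with w have "cells w x = 0" by (intro cells_outside)
  moreover have "0 \<le> B" using B[of 0 0] by linarith
  ultimately show ?thesis by simp
qed

section \<open>Derivatives supported in the unit interval\<close>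

text \<open>The primitive vanishes outside (0, 1) as well, so that rescaled copies can be put side
  by side without constants of integration. Countability of the discontinuities survives all
  constructions below and finally yields Riemann integrability.\<close>

definition supported_derivative :: "(real \<Rightarrow> real) \<Rightarrow> (real \<Rightarrow> real) \<Rightarrow> bool" where
  "supported_derivative f F \<longleftrightarrow>
     (\<forall>x. (F has_real_derivative f x) (at x)) \<and>
     (\<forall>x. x \<notin> {0<..<1} \<longrightarrow> f x = 0 \<and> F x = 0) \<and>
     countable {x. \<not> isCont f x}"

lemma supported_derivative_linear:
  assumes "supported_derivative f F" "supported_derivative h H"
  shows "supported_derivative (\<lambda>x. a * f x + b * h x) (\<lambda>x. a * F x + b * H x)"
  unfolding supported_derivative_def
proof (intro conjI allI)
  have "{x. \<not> isCont (\<lambda>x. a * f x + b * h x) x} \<subseteq> {x. \<not> isCont f x} \<union> {x. \<not> isCont h x}"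
    by (auto intro!: continuous_intros)
  then show "countable {x. \<not> isCont (\<lambda>x. a * f x + b * h x) x}"
    using assms unfolding supported_derivative_def by (meson countable_Un countable_subset)
qed (use assms in \<open>auto simp: supported_derivative_def intro!: derivative_eq_intros\<close>)

lemma countable_not_isCont_affine:
  fixes f :: "real \<Rightarrow> real"
  assumes "countable {x. \<not> isCont f x}" "m \<noteq> 0"
  shows "countable {x. \<not> isCont (\<lambda>x. f (m * x - d)) x}"
proof (rule countable_subset)
  show "countable ((\<lambda>y. (y + d) / m) ` {x. \<not> isCont f x})"
    using assms by blast
  show "{x. \<not> isCont (\<lambda>x. f (m * x - d)) x} \<subseteq> (\<lambda>y. (y + d) / m) ` {x. \<not> isCont f x}"
  proof
    fix x assume n: "x \<in> {x. \<not> isCont (\<lambda>x. f (m * x - d)) x}"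
    have "isCont (\<lambda>x. f (m * x - d)) x" if c: "isCont f (m * x - d)"
      by (rule isCont_o2[where f="\<lambda>x. m * x - d" and g=f]) (use c in \<open>auto intro!: continuous_intros\<close>)
    then have "m * x - d \<in> {x. \<not> isCont f x}" using n by blast
    then show "x \<in> (\<lambda>y. (y + d) / m) ` {x. \<not> isCont f x}"
      by (rule rev_image_eqI) (use assms in simp)
  qed
qed

text \<open>The assumptions on \<open>m\<close> and \<open>d\<close> place the interval
  [d / m, (d + 1) / m] that carries the copy inside [0, 1].\<close>

lemma supported_derivative_rescale:
  assumes f: "supported_derivative f F" and m: "m > 0" "d \<ge> 0" "d + 1 \<le> m"
  shows "supported_derivative (\<lambda>x. f (m * x - d)) (\<lambda>x. F (m * x - d) / m)"
  unfolding supported_derivative_def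
proof (intro conjI allI impI)
  fix x
  have "(F has_real_derivative f (m * x - d)) (at (m * x - d))"
    using f by (simp add: supported_derivative_def)
  then show "((\<lambda>x. F (m * x - d) / m) has_real_derivative f (m * x - d)) (at x)"
    using m by (auto intro!: derivative_eq_intros DERIV_chain2[where f=F])
next
  fix x :: real assume x: "x \<notin> {0<..<1}"
  have "m * x - d \<notin> {0<..<1}"
  proof (cases "x \<le> 0")
    case True
    then have "m * x \<le> 0" using m by (simp add: mult_nonneg_nonpos)
    then show ?thesis using m by simp
  next
    case False
    then have "m * 1 \<le> m * x" using x m by (intro mult_left_mono) auto
    then have "1 \<le> m * x - d" using m by linarith
    then show ?thesis by simp
  qed
  then show "f (m * x - d) = 0" "F (m * x - d) / m = 0"
    using f by (auto simp: supported_derivative_def)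
qed (use f m countable_not_isCont_affine in \<open>simp add: supported_derivative_def\<close>)

text \<open>Antisymmetry about 1/2 makes the integral over [0, 1] vanish, so the primitive that is 0
  to the left of 0 returns to 0 at 1.\<close>

lemma supported_derivative_odd:
  fixes u :: "real \<Rightarrow> real"
  assumes u: "continuous_on UNIV u" "\<And>x. x \<notin> {0<..<1} \<Longrightarrow> u x = 0" "\<And>x. u (1 - x) = - u x"
  shows "\<exists>U. supported_derivative u U"
proof -
  \<comment> \<open>Integration starts at -1 to make 0 an interior point, where the derivative is
    two-sided.\<close>
  define U where "U x = integral {-1..x} u" for x
  define V where "V x = (if x \<in> {0<..<1} then U x else 0)" for x
  have ui: "u integrable_on {a..b}" for a b
    using u(1) integrable_continuous_real continuous_on_subset by blast
  have D: "(U has_real_derivative u x) (at x)" if "x > -1" for x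
  proof -
    have "((\<lambda>u'. integral {-1..u'} u) has_real_derivative u x) (at x within {-1..x+1})"
      by (rule integral_has_real_derivative) (use u(1) that continuous_on_subset in auto)
    moreover have "at x within {-1..x+1} = at x"
      by (rule at_within_interior) (use that in auto)
    ultimately show ?thesis unfolding U_def by simp
  qed
  have U0: "U x = 0" if "x \<le> 0" for x
  proof -
    have "U x = integral {-1..x} (\<lambda>_. 0)" unfolding U_def
      by (rule integral_cong) (use u(2) that in auto)
    then show ?thesis by simp
  qed
  have U1: "U x = U 1" if "x \<ge> 1" for x
  proof -
    have "integral {-1..1} u + integral {1..x} u = integral {-1..x} u"
      by (rule Henstock_Kurzweil_Integration.integral_combine) (use that ui in auto)
    moreover have "integral {1..x} u = integral {1..x} (\<lambda>_. 0)"
      by (rule integral_cong) (use u(2) that in auto)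
    ultimately show ?thesis unfolding U_def by simp
  qed
  have D2: "((\<lambda>x. U (1 - x) - U x) has_real_derivative 0) (at x)" if "0 \<le> x" "x \<le> 1" for x
  proof -
    have "((\<lambda>x. 1 - x) has_real_derivative -1) (at x)" by (auto intro!: derivative_eq_intros)
    then have "((\<lambda>x. U (1 - x)) has_real_derivative u (1 - x) * (-1)) (at x)"
      by (rule DERIV_chain2[rotated]) (use that in \<open>auto intro!: D\<close>)
    then have "((\<lambda>x. U (1 - x) - U x) has_real_derivative u (1 - x) * (-1) - u x) (at x)"
      by (rule DERIV_diff) (use that in \<open>auto intro!: D\<close>)
    then show ?thesis using u(3) by simp
  qed
  \<comment> \<open>Since \<open>U 0 = 0\<close>, this reads \<open>- U 1 = U 1\<close>.\<close>
  have "U (1 - 1) - U 1 = U (1 - 0) - U 0"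
    by (rule DERIV_isconst2[of 0 1 "\<lambda>x. U (1 - x) - U x"])
      (use D2 in \<open>auto intro!: DERIV_atLeastAtMost_imp_continuous_on\<close>)
  then have "U 1 = 0" using U0[of 0] by simp
  then have VU: "V x = U x" for x using U0[of x] U1[of x] by (auto simp: V_def)
  have "((V) has_real_derivative u x) (at x)" for x
  proof (cases "x > -1")
    case True then show ?thesis using D VU by (metis ext)
  next
    case False
    have "((\<lambda>_. 0) has_real_derivative u x) (at x)" using u(2)[of x] False by simp
    then show ?thesis
      by (rule has_field_derivative_transform_within_open[of _ _ _ "{..<0}"]) (use False VU U0 in auto)
  qed
  moreover have "{x. \<not> isCont u x} = {}"
    using u(1) by (auto simp: continuous_on_eq_continuous_at)
  ultimately have "supported_derivative u V"
    unfolding supported_derivative_def using u(2) by (auto simp: V_def)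
  then show ?thesis by blast
qed

text \<open>The division by \<open>(real k + 1) * (real k + 2)\<close> compensates the slope of
  \<open>cell_coord k\<close>. Away from 0 the sums are locally finite; at 0, where the cells
  accumulate, the common bound \<open>B\<close> controls the primitive. Only 0 can be added to the
  discontinuities of the individual terms.\<close>

lemma supported_derivative_cells:
  assumes w: "\<And>k. supported_derivative (w k) (W k)" and B: "\<And>k z. \<bar>w k z\<bar> \<le> B"
  shows "supported_derivative (cells w)
    (cells (\<lambda>k z. W k z / ((real k + 1) * (real k + 2))))" (is "supported_derivative _ (cells ?W)")
proof -
  have w0: "z \<notin> {0<..<1} \<Longrightarrow> w k z = 0" and W0: "z \<notin> {0<..<1} \<Longrightarrow> W k z = 0"
    and WD: "(W k has_real_derivative w k z) (at z)"
    and wc: "countable {x. \<not> isCont (w k) x}" for k z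
    using w[of k] by (auto simp: supported_derivative_def)
  have W0': "z \<notin> {0<..<1} \<Longrightarrow> ?W k z = 0" for k z using W0 by simp
  have WB: "\<bar>W k z\<bar> \<le> B" if "z \<in> {0..1}" for k z
  proof -
    have "norm (W k z - W k 0) \<le> B * norm (z - 0)"
      by (rule field_differentiable_bound[of UNIV "W k" "w k"])
        (use WD B in \<open>auto intro: has_field_derivative_at_within\<close>)
    moreover have "B * \<bar>z\<bar> \<le> B * 1" using that B[of 0 0] by (intro mult_left_mono) auto
    ultimately show ?thesis using W0[of 0 k] by simp
  qed
  have B0: "B \<ge> 0" using B[of 0 0] by linarith
  \<comment> \<open>The cells near \<open>x\<close> have width of order \<open>x\<^sup>2\<close>, which gives derivative \<open>0\<close> at \<open>0\<close>.\<close>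
  have quad: "\<bar>cells ?W x\<bar> \<le> 2 * B * x\<^sup>2" for x
  proof (cases "x \<in> {0<..<1}")
    case True
    then obtain k z where kz: "0 < z" "z \<le> 1" "x = cell_point k z" by (auto elim: cell_point_cases)
    have "\<bar>cells ?W x\<bar> = \<bar>W k z\<bar> / ((real k + 1) * (real k + 2))"
      using cells_point[where w="?W" and z=z and k=k] W0' kz by (simp add: abs_mult)
    also have "\<dots> \<le> B / ((real k + 1) * (real k + 2))"
      using WB[of z k] kz by (intro divide_right_mono) auto
    also have "\<dots> \<le> B * (2 * (1 / (real k + 2))\<^sup>2)"
    proof -
      have "1 / ((real k + 1) * (real k + 2)) \<le> 2 * (1 / (real k + 2))\<^sup>2"
        by (simp add: divide_simps power2_eq_square)
      from mult_left_mono[OF this B0] show ?thesis by simp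
    qed
    also have "\<dots> \<le> B * (2 * x\<^sup>2)"
    proof -
      have "1 / (real k + 2) \<le> x" using kz by (simp add: cell_point_def divide_right_mono)
      then show ?thesis using B0 by (intro mult_left_mono power_mono) auto
    qed
    finally show ?thesis by simp
  next
    case False
    then show ?thesis using cells_outside[where w="?W" and x=x] W0' B0 by simp
  qed
  have local_sum: "\<exists>N S. open S \<and> x \<in> S \<and> (\<forall>y\<in>S. cells w y = (\<Sum>k<N. w k (cell_coord k y)))
      \<and> (\<forall>y\<in>S. cells ?W y = (\<Sum>k<N. ?W k (cell_coord k y)))" if x: "x > 0" for x
  proof -
    obtain N :: nat where "1 / x < real N" using reals_Archimedean2 by blast
    moreover have "1 / x > 0" using x by simp
    ultimately have N0: "N > 0" by (intro Nat.gr0I) auto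
    then have N: "1 / real N < x" using \<open>1 / x < real N\<close> x by (simp add: field_simps)
    show ?thesis
    proof (intro exI conjI ballI)
      show "open {1 / real N<..}" "x \<in> {1 / real N<..}" using N by auto
      fix y assume "y \<in> {1 / real N<..}"
      then have "y > 1 / real N" by simp
      moreover have "1 / real N > 0" using N0 by simp
      ultimately have "y > 0" "1 \<le> real N * y" using N0 
         apply linarith using \<open>y > 1 / real N\<close> N0 by (simp add: field_simps)
      then show "cells w y = (\<Sum>k<N. w k (cell_coord k y))" "cells ?W y = (\<Sum>k<N. ?W k (cell_coord k y))"
        by (intro cells_eq_sum w0 W0'; simp)+
    qed
  qed
  show ?thesis unfolding supported_derivative_def
  proof (intro conjI allI impI)
    fix x :: real
    consider "x < 0" | "x = 0" | "x > 0" by linarith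
    then show "(cells ?W has_real_derivative cells w x) (at x)"
    proof cases
      case 1
      have "((\<lambda>_. 0) has_real_derivative cells w x) (at x)" using 1 cells_nonpos by simp
      then show ?thesis
        by (rule has_field_derivative_transform_within_open[of _ _ _ "{..<0}"])
          (use 1 cells_nonpos in auto)
    next
      case 2
      have "((\<lambda>h. (cells ?W (0 + h) - cells ?W 0) / h) \<longlongrightarrow> 0) (at 0)"
      proof (rule Lim_null_comparison)
        show "\<forall>\<^sub>F h in at 0. norm ((cells ?W (0 + h) - cells ?W 0) / h) \<le> 2 * B * \<bar>h\<bar>"
          unfolding eventually_at
        proof (intro exI[of _ 1] conjI ballI impI)
          fix h :: real assume "h \<noteq> 0 \<and> dist h 0 < 1"
          then show "norm ((cells ?W (0 + h) - cells ?W 0) / h) \<le> 2 * B * \<bar>h\<bar>"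
            using quad[of h] cells_nonpos[of 0 ?W] by (simp add: divide_simps power2_eq_square abs_mult)
        qed simp
        show "((\<lambda>h. 2 * B * \<bar>h\<bar>) \<longlongrightarrow> 0) (at 0)" by (auto intro!: tendsto_eq_intros)
      qed
      then show ?thesis using 2 cells_nonpos by (simp add: DERIV_def)
    next
      case 3
      then obtain N S where S: "open S" "x \<in> S" "\<forall>y\<in>S. cells w y = (\<Sum>k<N. w k (cell_coord k y))"
        "\<forall>y\<in>S. cells ?W y = (\<Sum>k<N. ?W k (cell_coord k y))" using local_sum by meson
      have "((\<lambda>y. ?W k (cell_coord k y)) has_real_derivative w k (cell_coord k x)) (at x)" for k
      proof -
        have 1: "(cell_coord k has_real_derivative (real k + 1) * (real k + 2)) (at x)"
          unfolding cell_coord_def by (auto intro!: derivative_eq_intros)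
        have "((\<lambda>y. W k (cell_coord k y) / ((real k + 1) * (real k + 2))) has_real_derivative
          (w k (cell_coord k x) * ((real k + 1) * (real k + 2))) / ((real k + 1) * (real k + 2))) (at x)"
          by (rule DERIV_cdivide, rule DERIV_chain2[OF WD 1])
        then show ?thesis by simp
      qed
      then have "((\<lambda>y. \<Sum>k<N. ?W k (cell_coord k y)) has_real_derivative (\<Sum>k<N. w k (cell_coord k x))) (at x)"
        by (rule DERIV_sum)
      then show ?thesis using S
        by (intro has_field_derivative_transform_within_open[of "\<lambda>y. \<Sum>k<N. ?W k (cell_coord k y)" _ _ S "cells ?W"])
          auto
    qed
  next
    fix x :: real assume "x \<notin> {0<..<1}"
    then show "cells w x = 0" "cells ?W x = 0" by (auto intro!: cells_outside w0 W0')
  next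
    have "{x. \<not> isCont (cells w) x} \<subseteq> {0} \<union> (\<Union>k. {x. \<not> isCont (\<lambda>x. w k (cell_coord k x)) x})"
    proof clarify
      fix x assume x: "\<not> isCont (cells w) x" "x \<notin> (\<Union>k. {x. \<not> isCont (\<lambda>x. w k (cell_coord k x)) x})" "x \<notin> {}"
      consider "x < 0" | "x = 0" | "x > 0" by linarith
      then show "x = 0"
      proof cases
        case 1
        have "isCont (cells w) x \<longleftrightarrow> isCont (\<lambda>_. 0::real) x"
          by (rule isCont_cong, rule eventually_nhds_in_open[of "{..<0}", THEN eventually_mono])
            (use 1 cells_nonpos in auto)
        then show ?thesis using x by simp
      next
        case 3
        then obtain N S where S: "open S" "x \<in> S" "\<forall>y\<in>S. cells w y = (\<Sum>k<N. w k (cell_coord k y))"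
          using local_sum by meson
        have "isCont (cells w) x \<longleftrightarrow> isCont (\<lambda>y. \<Sum>k<N. w k (cell_coord k y)) x"
          by (rule isCont_cong, rule eventually_nhds_in_open[of S, THEN eventually_mono])
            (use S in auto)
        moreover have "isCont (\<lambda>y. \<Sum>k<N. w k (cell_coord k y)) x"
          using x by (intro continuous_intros) auto
        ultimately show ?thesis using x by simp
      qed
    qed
    moreover have "countable {x. \<not> isCont (\<lambda>x. w k (cell_coord k x)) x}" for k
    proof -
      have "(\<lambda>x. w k (cell_coord k x)) = (\<lambda>x. w k (((real k + 1) * (real k + 2)) * x - (real k + 1)))"
        by (simp add: cell_coord_def algebra_simps)
      moreover have "(real k + 1) * (real k + 2) > 0" by simp
      ultimately show ?thesis using countable_not_isCont_affine[OF wc[of k], of "(real k + 1) * (real k + 2)" "real k + 1"] by simp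
    qed
    then have "countable ({0} \<union> (\<Union>k. {x. \<not> isCont (\<lambda>x. w k (cell_coord k x)) x}))"
      by (intro countable_Un countable_UN) auto
    ultimately show "countable {x. \<not> isCont (cells w) x}"
      by (rule countable_subset)
  qed
qed

text \<open>The derivatives converge uniformly and the primitives all vanish at 0, so the limit may
  be differentiated termwise. A uniform limit is continuous wherever every \<open>f n\<close> is,
  hence its discontinuities lie in a countable union of countable sets.\<close>

lemma supported_derivative_limit:
  assumes f: "\<And>n. supported_derivative (f n) (F n)" and lim: "uniform_limit UNIV f Z sequentially"
  shows "\<exists>F. supported_derivative Z F"
proof -
  have "\<exists>G. \<forall>x\<in>UNIV. (\<lambda>n. F n x) \<longlonglongrightarrow> G x \<and> (G has_derivative ((*) (Z x))) (at x within UNIV)"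
  proof (rule has_derivative_sequence[where ?x0.0 = 0 and l = 0])
    show "(F n has_derivative ((*) (f n x))) (at x within UNIV)" for n x
      using f[of n] by (simp add: supported_derivative_def has_field_derivative_def)
    show "\<forall>\<^sub>F n in sequentially. \<forall>x\<in>UNIV. \<forall>h. norm (f n x * h - Z x * h) \<le> e * norm h"
      if "e > 0" for e
    proof -
      have "\<forall>\<^sub>F n in sequentially. \<forall>x\<in>UNIV. dist (f n x) (Z x) < e"
        using lim that by (simp add: uniform_limit_iff)
      then show ?thesis
      proof (rule eventually_mono, intro ballI allI)
        fix n x h assume "\<forall>x\<in>UNIV. dist (f n x) (Z x) < e"
        then have "\<bar>f n x - Z x\<bar> * \<bar>h\<bar> \<le> e * \<bar>h\<bar>"
          by (intro mult_right_mono) (auto simp: dist_real_def less_imp_le)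
        then show "norm (f n x * h - Z x * h) \<le> e * norm h"
          by (simp add: abs_mult flip: left_diff_distrib)
      qed
    qed
    show "(\<lambda>n. F n 0) \<longlonglongrightarrow> 0" using f by (simp add: supported_derivative_def)
  qed auto
  then obtain G where G: "\<And>x. (\<lambda>n. F n x) \<longlonglongrightarrow> G x" "\<And>x. (G has_real_derivative Z x) (at x)"
    by (auto simp: has_field_derivative_def)
  have Zlim: "(\<lambda>n. f n x) \<longlonglongrightarrow> Z x" for x using tendsto_uniform_limitI[OF lim] by simp
  have "Z x = 0" "G x = 0" if "x \<notin> {0<..<1}" for x
  proof -
    have "f n x = 0" "F n x = 0" for n using f[of n] that by (auto simp: supported_derivative_def)
    then show "Z x = 0" "G x = 0" using Zlim[of x] G(1)[of x] by (simp_all add: LIMSEQ_const_iff)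
  qed
  moreover have "countable {x. \<not> isCont Z x}"
  proof (rule countable_subset)
    show "countable (\<Union>n. {x. \<not> isCont (f n) x})"
      using f by (intro countable_UN) (auto simp: supported_derivative_def)
    show "{x. \<not> isCont Z x} \<subseteq> (\<Union>n. {x. \<not> isCont (f n) x})"
    proof (rule subsetI, rule ccontr)
      fix x assume n: "x \<in> {x. \<not> isCont Z x}" "x \<notin> (\<Union>n. {x. \<not> isCont (f n) x})"
      have "isCont Z x" unfolding isCont_def
      proof (rule swap_uniform_limit[OF _ Zlim])
        show "\<forall>\<^sub>F n in sequentially. (f n \<longlongrightarrow> f n x) (at x)"
          using n(2) by (auto simp: isCont_def)
        show "uniform_limit UNIV f Z sequentially" by (rule lim)
      qed auto
      with n show False by simp
    qed
  qed
  ultimately show ?thesis using G(2) unfolding supported_derivative_def by blast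
qed

section \<open>The self-similar derivative\<close>

definition bump :: "real \<Rightarrow> real" where
  "bump s = max 0 (min 1 (2 - 8 * \<bar>s\<bar>))"

text \<open>Two trapezoids with ramps of slope 8 or -8: a crest on [1/8, 3/8] and a trough on
  [5/8, 7/8]. Between them the two falling ramps join to one straight line through (1/2, 0), so the
  wave is flat on no other interval inside (0, 1).\<close>

definition wave :: "real \<Rightarrow> real" where
  "wave z = bump (z - 1/4) - bump (z - 3/4)"

text \<open>
  The copy on the crest \<open>[1/8, 3/8]\<close> is negated: \<open>f\<close> will be increasing to \<open>0\<close> near \<open>1\<close>, so that
  the right end of a crest is not an extremum. The two factors keep the values in \<open>(-1, 1)\<close>.
\<close>

definition step :: "(real \<Rightarrow> real) \<Rightarrow> nat \<Rightarrow> real \<Rightarrow> real" where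
  "step f k z = (1 - 1 / (real k + 4)) *
     (wave z + 1 / (real k + 4) * (f (4 * z - 5/2) - f (4 * z - 1/2)))"

text \<open>Picard iteration for the fixed-point equation \<open>Z = cells (step Z)\<close>.\<close>

primrec iter :: "nat \<Rightarrow> real \<Rightarrow> real" where
  "iter 0 = (\<lambda>_. 0)"
| "iter (Suc n) = cells (step (iter n))"

lemma wave_supported: "\<exists>T. supported_derivative wave T"
proof (rule supported_derivative_odd)
  show "continuous_on UNIV wave" unfolding wave_def bump_def by (intro continuous_intros)
qed (auto simp: wave_def bump_def min_def max_def abs_if)

lemma step_supported:
  assumes f: "supported_derivative f F"
  shows "\<exists>W. supported_derivative (step f k) W"
proof -
  let ?c = "1 / (real k + 4)"
  obtain T where T: "supported_derivative wave T" using wave_supported ..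
  have a: "supported_derivative (\<lambda>x. f (4 * x - 5/2)) (\<lambda>x. F (4 * x - 5/2) / 4)"
    and b: "supported_derivative (\<lambda>x. f (4 * x - 1/2)) (\<lambda>x. F (4 * x - 1/2) / 4)"
    by (rule supported_derivative_rescale[OF f]; simp)+
  have "step f k = (\<lambda>z. (1 - ?c) * wave z + ((1 - ?c) * ?c) * (1 * f (4 * z - 5/2) + (-1) * f (4 * z - 1/2)))"
    unfolding step_def by (rule ext) (simp add: distrib_left right_diff_distrib mult.assoc)
  moreover note supported_derivative_linear[OF T supported_derivative_linear[OF a b, of 1 "-1"],
      of "1 - ?c" "(1 - ?c) * ?c"]
  ultimately show ?thesis by auto
qed

text \<open>With \<open>c = 1 / (real k + 4)\<close> the bound is (1 - c) (1 + c): the factor 1 - c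
  leaves room for the height c of the copy on top of the wave. That it stays strictly below 1 in
  each cell is essential later.\<close>

lemma step_abs_le:
  assumes f: "\<And>x. \<bar>f x\<bar> \<le> 1" "\<And>x. x \<notin> {0<..<1} \<Longrightarrow> f x = 0"
  shows "\<bar>step f k z\<bar> \<le> 1 - (1 / (real k + 4))\<^sup>2"
proof -
  define c where "c = 1 / (real k + 4)"
  have c: "0 < c" "c \<le> 1/4" by (auto simp: c_def field_simps)
  have w: "\<bar>wave z\<bar> \<le> 1" by (auto simp: wave_def bump_def min_def max_def abs_if)
  \<comment> \<open>The two arguments differ by 2, so at most one of them lies in (0, 1).\<close>
  have "f (4 * z - 5/2) = 0 \<or> f (4 * z - 1/2) = 0"
    using f(2)[of "4 * z - 5/2"] f(2)[of "4 * z - 1/2"] by fastforce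
  then have d: "\<bar>f (4 * z - 5/2) - f (4 * z - 1/2)\<bar> \<le> 1" using f(1) by auto
  have "\<bar>c * (f (4 * z - 5/2) - f (4 * z - 1/2))\<bar> \<le> c * 1"
    unfolding abs_mult using c d by (intro mult_mono) auto
  then have "\<bar>wave z + c * (f (4 * z - 5/2) - f (4 * z - 1/2))\<bar> \<le> 1 + c" using w by linarith
  then have "\<bar>step f k z\<bar> \<le> (1 - c) * (1 + c)"
    unfolding step_def abs_mult c_def[symmetric] using c by (intro mult_mono) auto
  then show ?thesis unfolding c_def[symmetric] by (simp add: algebra_simps power2_eq_square)
qed

text \<open>The contraction estimate: each of the two copies enters with a factor of at most
  1/4.\<close>

lemma step_diff_le:
  assumes "\<And>x. \<bar>f x - h x\<bar> \<le> d"
  shows "\<bar>step f k z - step h k z\<bar> \<le> d / 2"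
proof -
  define c where "c = 1 / (real k + 4)"
  have c: "0 < c" "c \<le> 1/4" by (auto simp: c_def field_simps)
  let ?a = "(f (4 * z - 5/2) - h (4 * z - 5/2)) - (f (4 * z - 1/2) - h (4 * z - 1/2))"
  have "step f k z - step h k z = (1 - c) * c * ?a"
    unfolding step_def c_def[symmetric] by (simp add: algebra_simps)
  also have "\<bar>\<dots>\<bar> \<le> (1 * (1/4)) * (d + d)"
    unfolding abs_mult using c assms[of "4 * z - 5/2"] assms[of "4 * z - 1/2"]
    by (intro mult_mono) auto
  finally show ?thesis by simp
qed

lemma iter_supported_bounded: "(\<exists>F. supported_derivative (iter n) F) \<and> (\<forall>x. \<bar>iter n x\<bar> \<le> 1)"
proof (induction n)
  case 0
  have "supported_derivative (\<lambda>_. 0) (\<lambda>_. 0)" by (simp add: supported_derivative_def)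
  then show ?case by auto
next
  case (Suc n)
  then obtain F where F: "supported_derivative (iter n) F" by blast
  then have "\<forall>k. \<exists>W. supported_derivative (step (iter n) k) W" using step_supported by blast
  then obtain W where W: "\<And>k. supported_derivative (step (iter n) k) (W k)" by metis
  have B: "\<bar>step (iter n) k z\<bar> \<le> 1" for k z
  proof -
    have "\<bar>step (iter n) k z\<bar> \<le> 1 - (1 / (real k + 4))\<^sup>2"
      using Suc F by (intro step_abs_le) (auto simp: supported_derivative_def)
    moreover have "0 \<le> (1 / (real k + 4))\<^sup>2" by simp
    ultimately show ?thesis by linarith
  qed
  have "\<exists>F. supported_derivative (iter (Suc n)) F"
    using supported_derivative_cells[where w="step (iter n)", OF W B] by auto
  moreover have "\<bar>iter (Suc n) x\<bar> \<le> 1" for x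
    using W B by (auto intro!: cells_abs_le simp: supported_derivative_def)
  ultimately show ?case by blast
qed

lemma step_outside:
  assumes "\<And>x. x \<notin> {0<..<1} \<Longrightarrow> f x = 0" "z \<notin> {0<..<1}"
  shows "step f k z = 0"
proof -
  have "wave z = 0" using assms(2) by (auto simp: wave_def bump_def min_def max_def abs_if)
  moreover have "f (4 * z - 5/2) = 0" "f (4 * z - 1/2) = 0" using assms by auto
  ultimately show ?thesis by (simp add: step_def)
qed

lemma iter_outside: "x \<notin> {0<..<1} \<Longrightarrow> iter n x = 0"
  using iter_supported_bounded[of n] by (auto simp: supported_derivative_def)

lemma iter_point: "z \<in> {0..1} \<Longrightarrow> iter (Suc n) (cell_point k z) = step (iter n) k z"
  using cells_point[where w="step (iter n)" and z=z and k=k] step_outside[where f="iter n"] iter_outside[of _ n]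
  by auto

text \<open>\<open>cells\<close> is linear in the family of functions on the cells and preserves a
  common bound on them, so the contraction of \<open>step\<close> carries over to the
  iterates.\<close>

lemma iter_diff_le: "\<bar>iter (Suc n) x - iter n x\<bar> \<le> (1/2) ^ n"
proof (induction n arbitrary: x)
  case 0 show ?case using iter_supported_bounded[of "Suc 0"] by simp
next
  case (Suc n)
  let ?w = "\<lambda>k z. step (iter (Suc n)) k z - step (iter n) k z"
  have "iter (Suc (Suc n)) x - iter (Suc n) x = cells ?w x"
    by (simp add: cells_def sum_subtractf)
  also have "\<bar>\<dots>\<bar> \<le> (1/2) ^ n / 2"
  proof (rule cells_abs_le)
    show "z \<notin> {0<..<1} \<Longrightarrow> ?w k z = 0" for k z
      using step_outside[where f="iter n"] step_outside[where f="iter (Suc n)"]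
        iter_outside[of _ n] iter_outside[of _ "Suc n"] by auto
    show "\<bar>?w k z\<bar> \<le> (1/2) ^ n / 2" for k z by (rule step_diff_le) (rule Suc.IH)
  qed
  finally show ?case by simp
qed

text \<open>This is all that the argument about extrema uses of the limit; differentiability is
  recorded separately.\<close>

definition self_similar :: "(real \<Rightarrow> real) \<Rightarrow> bool" where
  "self_similar Z \<longleftrightarrow> (\<forall>x. x \<notin> {0<..<1} \<longrightarrow> Z x = 0) \<and> (\<forall>x. \<bar>Z x\<bar> \<le> 1) \<and>
     (\<forall>k. \<forall>z\<in>{0..1}. Z (cell_point k z) = step Z k z)"

text \<open>The increments of the iteration are dominated by a geometric series, so the Weierstrass
  test gives uniform convergence. The fixed-point equation follows by passing to the limit at each
  point in the recursion for \<open>iter (Suc n)\<close>.\<close>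

lemma self_similar_exists: "\<exists>Z F. self_similar Z \<and> supported_derivative Z F"
proof -
  define Z where "Z x = (\<Sum>i. iter (Suc i) x - iter i x)" for x
  have "uniform_limit UNIV (\<lambda>n x. \<Sum>i<n. iter (Suc i) x - iter i x) Z sequentially"
    unfolding Z_def
    by (rule Weierstrass_m_test[where M = "\<lambda>n. (1/2) ^ n"])
      (use iter_diff_le in \<open>auto intro!: summable_geometric simp del: iter.simps\<close>)
  moreover have "(\<Sum>i<n. iter (Suc i) x - iter i x) = iter n x" for n x
    using sum_lessThan_telescope[of "\<lambda>i. iter i x" n] by simp
  ultimately have lim: "uniform_limit UNIV iter Z sequentially" by simp
  have plim: "(\<lambda>n. iter n x) \<longlonglongrightarrow> Z x" for x using tendsto_uniform_limitI[OF lim] by simp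
  have "\<forall>n. \<exists>F. supported_derivative (iter n) F" using iter_supported_bounded by blast
  then obtain F where "\<And>n. supported_derivative (iter n) (F n)" by metis
  then obtain G where G: "supported_derivative Z G" using supported_derivative_limit lim by blast
  have "\<bar>Z x\<bar> \<le> 1" for x
    by (rule tendsto_le[OF _ tendsto_const tendsto_rabs[OF plim]])
      (use iter_supported_bounded in auto)
  moreover have "Z (cell_point k z) = step Z k z" if "z \<in> {0..1}" for k z
  proof (rule LIMSEQ_unique)
    show "(\<lambda>n. iter (Suc n) (cell_point k z)) \<longlonglongrightarrow> Z (cell_point k z)" by (rule LIMSEQ_Suc[OF plim])
    show "(\<lambda>n. iter (Suc n) (cell_point k z)) \<longlonglongrightarrow> step Z k z"
      unfolding iter_point[OF that] step_def by (intro tendsto_intros plim)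
  qed
  ultimately have "self_similar Z" using G unfolding self_similar_def supported_derivative_def by blast
  with G show ?thesis by blast
qed

section \<open>Absence of local extrema in the self-similar function\<close>

text \<open>A quantitative form of not being a local extremum: both strict inequalities are
  witnessed at distance less than \<open>r\<close>. With \<open>r\<close> explicit, the descent to
  smaller scales becomes an induction.\<close>

definition crosses :: "real \<Rightarrow> (real \<Rightarrow> real) \<Rightarrow> real \<Rightarrow> bool" where
  "crosses r f p \<longleftrightarrow>
     (\<exists>x\<in>{0<..<1}. \<exists>y\<in>{0<..<1}. \<bar>x - p\<bar> < r \<and> \<bar>y - p\<bar> < r \<and> f x < f p \<and> f p < f y)"

lemma crosses_affine:
  assumes f: "\<And>t. a < t \<Longrightarrow> t < b \<Longrightarrow> f t = \<alpha> * t + \<beta>" "\<alpha> \<noteq> 0"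
    and z: "a < z" "z < b" "0 \<le> a" "b \<le> 1" and r: "r > 0"
  shows "crosses r f z"
proof -
  define e where "e = min r (min (z - a) (b - z)) / 2"
  have e: "0 < e" "e < r" "e < z - a" "e < b - z" using z r by (auto simp: e_def)
  have v: "f (z + e) = f z + \<alpha> * e" "f (z - e) = f z - \<alpha> * e"
    using e z f(1) by (auto simp: algebra_simps)
  show ?thesis
  proof (cases "\<alpha> > 0")
    case True
    then have "\<alpha> * e > 0" using e by simp
    then show ?thesis unfolding crosses_def
      by (intro bexI[of _ "z - e"] bexI[of _ "z + e"]) (use e v z in auto)
  next
    case False
    then have "\<alpha> * e < 0" using e f(2) by (simp add: mult_less_0_iff)
    then show ?thesis unfolding crosses_def
      by (intro bexI[of _ "z + e"] bexI[of _ "z - e"]) (use e v z in auto)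
  qed
qed

text \<open>Witnesses for the copy are pulled back by a map that contracts by \<open>m\<close>, so
  they only come closer. A negative \<alpha> exchanges the roles of the two witnesses.\<close>

lemma crosses_plateau:
  assumes f: "\<And>t. m * t - d \<in> {0..1} \<Longrightarrow> V t = \<alpha> * f (m * t - d) + \<beta>" "\<alpha> \<noteq> 0"
    and m: "m \<ge> 1" "0 \<le> d" "d + 1 \<le> m"
    and c: "crosses r f (m * z - d)" "m * z - d \<in> {0<..<1}"
  shows "crosses r V z"
proof -
  obtain x y where xy: "x \<in> {0<..<1}" "y \<in> {0<..<1}" "\<bar>x - (m * z - d)\<bar> < r" "\<bar>y - (m * z - d)\<bar> < r"
    "f x < f (m * z - d)" "f (m * z - d) < f y" using c unfolding crosses_def by blast
  have pull: "\<bar>(t + d) / m - z\<bar> < r" "(t + d) / m \<in> {0<..<1}" "V ((t + d) / m) = \<alpha> * f t + \<beta>"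
    if "t \<in> {0<..<1}" "\<bar>t - (m * z - d)\<bar> < r" for t
  proof -
    have mt: "m * ((t + d) / m) - d = t" using m by simp
    then show "V ((t + d) / m) = \<alpha> * f t + \<beta>" using f(1)[of "(t + d) / m"] that by simp
    show "(t + d) / m \<in> {0<..<1}" using that m by (auto simp: field_simps)
    have "(t + d) / m - z = (t - (m * z - d)) / m" using m by (simp add: field_simps)
    then have "\<bar>(t + d) / m - z\<bar> = \<bar>t - (m * z - d)\<bar> / m" using m by (simp add: abs_divide)
    also have "\<dots> \<le> \<bar>t - (m * z - d)\<bar> / 1" using m by (intro divide_left_mono) auto
    finally show "\<bar>(t + d) / m - z\<bar> < r" using that by simp
  qed
  have vz: "V z = \<alpha> * f (m * z - d) + \<beta>" using f(1)[of z] c by auto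
  show ?thesis
  proof (cases "\<alpha> > 0")
    case True
    then have "\<alpha> * f x < \<alpha> * f (m * z - d)" "\<alpha> * f (m * z - d) < \<alpha> * f y" using xy by auto
    then show ?thesis unfolding crosses_def
      by (intro bexI[of _ "(x + d) / m"] bexI[of _ "(y + d) / m"]) (use pull xy vz in auto)
  next
    case False
    then have "\<alpha> < 0" using f by simp
    then have "\<alpha> * f y < \<alpha> * f (m * z - d)" "\<alpha> * f (m * z - d) < \<alpha> * f x"
      using xy by auto
    then show ?thesis unfolding crosses_def
      by (intro bexI[of _ "(y + d) / m"] bexI[of _ "(x + d) / m"]) (use pull xy vz in auto)
  qed
qed

text \<open>Every cell has width at most 1/2, so passing from cell coordinates to the line halves
  the scale. At an end point common to two cells the last two assumptions on \<open>V\<close> make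
  \<open>f\<close> rise strictly through the value there, on both sides.\<close>

lemma crosses_cells:
  assumes f: "\<And>k z. z \<in> {0..1} \<Longrightarrow> f (cell_point k z) = V k z"
    and i: "\<And>k z. z \<in> {0<..<1} \<Longrightarrow> crosses r (V k) z" and r: "r > 0"
    and l: "\<And>k z. 0 < z \<Longrightarrow> z < 1/8 \<Longrightarrow> V k 0 < V k z"
    and u: "\<And>k z. 7/8 < z \<Longrightarrow> z < 1 \<Longrightarrow> V k z < V k 1"
    and p: "p \<in> {0<..<1}"
  shows "crosses (r / 2) f p"
proof -
  obtain k z where kz: "0 < z" "z \<le> 1" "p = cell_point k z" using p by (auto elim: cell_point_cases)
  have d: "\<bar>cell_point j x - cell_point j y\<bar> \<le> \<bar>x - y\<bar> / 2" for j x y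
  proof -
    have j: "real j + 1 > 0" "real j + 2 > 0" by linarith+
    have "cell_point j x - cell_point j y = (x - y) / ((real j + 1) * (real j + 2))"
      unfolding cell_point_def using j by (simp add: divide_simps)
    then have "\<bar>cell_point j x - cell_point j y\<bar> = \<bar>x - y\<bar> / ((real j + 1) * (real j + 2))"
      by (simp add: abs_divide abs_mult)
    also have "\<dots> \<le> \<bar>x - y\<bar> / 2"
    proof (rule divide_left_mono)
      show "2 \<le> (real j + 1) * (real j + 2)" by (simp add: algebra_simps)
    qed auto
    finally show ?thesis .
  qed
  have in01: "cell_point j x \<in> {0<..<1}" if "x \<in> {0<..<1}" for j x
    using that cell_point_pos[of x j] cell_point_less_1[of x j] by simp
  show ?thesis
  proof (cases "z < 1")
    case True
    then obtain x y where xy: "x \<in> {0<..<1}" "y \<in> {0<..<1}" "\<bar>x - z\<bar> < r" "\<bar>y - z\<bar> < r"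
      "V k x < V k z" "V k z < V k y" using i[of z k] kz unfolding crosses_def by auto
    then show ?thesis unfolding crosses_def
      by (intro bexI[of _ "cell_point k x"] bexI[of _ "cell_point k y"])
        (use kz in01 f d[of k x z] d[of k y z] in auto)
  next
    case False
    then have z: "z = 1" using kz by simp
    have "k \<noteq> 0" using p kz z by (auto simp: cell_point_1)
    then obtain j where j: "k = Suc j" using not0_implies_Suc by blast
    have p0: "p = cell_point j 0" using kz z j by (simp add: cell_point_0 cell_point_1)
    define e where "e = min r (1/8) / 2"
    have e: "0 < e" "e < 1/8" "e < r" using r by (auto simp: e_def)
    have "f (cell_point k (1 - e)) < f p" using f[of "1 - e" k] f[of 1 k] u[of "1 - e" k] e kz z by simp
    moreover have "f p < f (cell_point j e)" using f[of e j] f[of 0 j] l[of e j] e p0 by simp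
    moreover have "\<bar>cell_point k (1 - e) - p\<bar> < r / 2" using d[of k "1 - e" 1] e kz z by simp
    moreover have "\<bar>cell_point j e - p\<bar> < r / 2" using d[of j e 0] e p0 by simp
    ultimately show ?thesis unfolding crosses_def
      by (intro bexI[of _ "cell_point k (1 - e)"] bexI[of _ "cell_point j e"]) (use in01 e in auto)
  qed
qed

context
  fixes Z :: "real \<Rightarrow> real"
  assumes Z: "self_similar Z"
begin

lemma Z_outside: "x \<notin> {0<..<1} \<Longrightarrow> Z x = 0"
  using Z by (simp add: self_similar_def)

lemma Z_point: "z \<in> {0..1} \<Longrightarrow> Z (cell_point k z) = step Z k z"
  using Z by (simp add: self_similar_def)

lemma Z_abs_less: "\<bar>Z x\<bar> < 1"
proof (cases "x \<in> {0<..<1}")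
  case True
  then obtain k z where kz: "0 < z" "z \<le> 1" "x = cell_point k z" by (auto elim: cell_point_cases)
  then have "\<bar>Z x\<bar> \<le> 1 - (1 / (real k + 4))\<^sup>2"
    using step_abs_le[of Z k z] Z Z_point[of z k] by (simp add: self_similar_def)
  moreover have "0 < (1 / (real k + 4))\<^sup>2" by (intro zero_less_power) simp
  ultimately show ?thesis by linarith
qed (simp add: Z_outside)

text \<open>The pieces are rising ramp, crest, falling ramp, trough, rising ramp. The right-hand
  sides, including \<open>+ 0\<close>, have the shape \<open>\<alpha> * _ + \<beta>\<close> to which
  the crossing lemmas are applied.\<close>

lemma step_pieces:
  defines "c \<equiv> \<lambda>k::nat. 1 / (real k + 4)"
  shows "0 \<le> z \<Longrightarrow> z \<le> 1/8 \<Longrightarrow> step Z k z = (8 * (1 - c k)) * z + 0"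
    and "4 * z - 1/2 \<in> {0..1} \<Longrightarrow> step Z k z = (- (1 - c k) * c k) * Z (4 * z - 1/2) + (1 - c k)"
    and "3/8 \<le> z \<Longrightarrow> z \<le> 5/8 \<Longrightarrow> step Z k z = (- 8 * (1 - c k)) * z + 4 * (1 - c k)"
    and "4 * z - 5/2 \<in> {0..1} \<Longrightarrow> step Z k z = ((1 - c k) * c k) * Z (4 * z - 5/2) + - (1 - c k)"
    and "7/8 \<le> z \<Longrightarrow> z \<le> 1 \<Longrightarrow> step Z k z = (8 * (1 - c k)) * z + - 8 * (1 - c k)"
proof -
  have s: "step Z k z = (1 - c k) * (wave z + c k * (Z (4 * z - 5/2) - Z (4 * z - 1/2)))" for z
    by (simp add: step_def c_def)
  show "step Z k z = (8 * (1 - c k)) * z + 0" if "0 \<le> z" "z \<le> 1/8"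
  proof -
    have "wave z = 8 * z" using that by (auto simp: wave_def bump_def min_def max_def abs_if)
    then show ?thesis unfolding s using that by (simp add: Z_outside)
  qed
  show "step Z k z = (- (1 - c k) * c k) * Z (4 * z - 1/2) + (1 - c k)" if "4 * z - 1/2 \<in> {0..1}"
  proof -
    have "wave z = 1" using that by (auto simp: wave_def bump_def min_def max_def abs_if)
    moreover have "Z (4 * z - 5/2) = 0" using that by (intro Z_outside) auto
    ultimately show ?thesis unfolding s by (simp add: algebra_simps)
  qed
  show "step Z k z = (- 8 * (1 - c k)) * z + 4 * (1 - c k)" if "3/8 \<le> z" "z \<le> 5/8"
  proof -
    have "wave z = 4 - 8 * z" using that by (auto simp: wave_def bump_def min_def max_def abs_if)
    moreover have "Z (4 * z - 5/2) = 0" "Z (4 * z - 1/2) = 0" using that by (auto intro!: Z_outside)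
    ultimately show ?thesis unfolding s by (simp only:) (simp add: algebra_simps)
  qed
  show "step Z k z = ((1 - c k) * c k) * Z (4 * z - 5/2) + - (1 - c k)" if "4 * z - 5/2 \<in> {0..1}"
  proof -
    have "wave z = -1" using that by (auto simp: wave_def bump_def min_def max_def abs_if)
    moreover have "Z (4 * z - 1/2) = 0" using that by (intro Z_outside) auto
    ultimately show ?thesis unfolding s by (simp add: algebra_simps)
  qed
  show "step Z k z = (8 * (1 - c k)) * z + - 8 * (1 - c k)" if "7/8 \<le> z" "z \<le> 1"
  proof -
    have "wave z = 8 * z - 8" using that by (auto simp: wave_def bump_def min_def max_def abs_if)
    moreover have "Z (4 * z - 5/2) = 0" "Z (4 * z - 1/2) = 0" using that by (auto intro!: Z_outside)
    ultimately show ?thesis unfolding s by (simp only:) (simp add: algebra_simps)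
  qed
qed

lemma Z_half: "Z (1/2) = 0"
proof -
  have "cell_point 0 0 = 1/2" by (simp add: cell_point_def)
  then show ?thesis using Z_point[of 0 0] step_pieces(1)[of 0 0] by (metis add_0 atLeastAtMost_iff
      divide_nonneg_nonneg mult_zero_right order_refl zero_le_one zero_le_numeral)
qed

text \<open>The points 1/4 and 3/4 are the midpoints of crest and trough, where the copy contributes
  \<open>Z (1/2) = 0\<close>; hence the values are exactly plus and minus the amplitude of the
  cell.\<close>

lemma Z_quarters:
  "Z (cell_point k (1/4)) = 1 - 1 / (real k + 4)" "Z (cell_point k (3/4)) = - (1 - 1 / (real k + 4))"
  using Z_point[of "1/4" k] step_pieces(2)[of "1/4" k] Z_point[of "3/4" k] step_pieces(4)[of "3/4" k] Z_half
  by simp_all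

text \<open>In each cell the crest precedes the trough. The order \<open>y < x\<close> will show
  that the final derivative is not increasing to the right of 0.\<close>

lemma Z_near_0:
  assumes "d > 0"
  obtains x y where "x \<in> {0<..<1}" "x < d" "Z x < 0" "y \<in> {0<..<1}" "y < x" "Z y > 0"
proof -
  obtain k :: nat where k: "1 / d < real k" using reals_Archimedean2 by blast
  have "1 / d > 0" using assms by simp
  then have k0: "real k > 0" using k by linarith
  have q: "Z (cell_point k (1/4)) > 0" "Z (cell_point k (3/4)) < 0" unfolding Z_quarters by (auto simp: field_simps)
  have "cell_point k (3/4) < cell_point k 1" by (simp add: cell_point_less_iff)
  also have "\<dots> = 1 / (real k + 1)" by (rule cell_point_1)
  also have "\<dots> \<le> 1 / real k" using k0 by (simp add: frac_le)
  also have "\<dots> < d" using k k0 assms by (simp add: field_simps)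
  finally have "cell_point k (3/4) < d" .
  then show ?thesis using that[of "cell_point k (3/4)" "cell_point k (1/4)"] q
      cell_point_pos[of "3/4" k] cell_point_pos[of "1/4" k] cell_point_less_1[of "3/4" k] cell_point_less_1[of "1/4" k]
    by (simp add: cell_point_less_iff)
qed

lemma Z_near_1:
  assumes "d > 0"
  obtains x where "x \<in> {0<..<1}" "1 - d < x" "Z x < 0"
proof -
  define e where "e = min d (1/8) / 2"
  have e: "0 < e" "e < d" "e < 1/8" using assms by (auto simp: e_def)
  have "Z (cell_point 0 (1 - e)) = (8 * (1 - 1/4)) * (1 - e) + - 8 * (1 - 1/4)"
    using Z_point[of "1 - e" 0] step_pieces(5)[of "1 - e" 0] e by simp
  then have "Z (cell_point 0 (1 - e)) < 0" using e by simp
  moreover have "cell_point 0 (1 - e) = 1 - e / 2" by (simp add: cell_point_def field_simps)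
  ultimately show ?thesis using that[of "1 - e / 2"] e by simp
qed

text \<open>\<open>Z\<close> takes both signs arbitrarily close to 0, so both witnesses are found
  inside the plateau.\<close>

lemma crosses_left_end:
  assumes f: "\<And>t. m * t - d \<in> {0..1} \<Longrightarrow> V t = \<alpha> * Z (m * t - d) + \<beta>" "\<alpha> \<noteq> 0"
    and m: "m \<ge> 1" "0 \<le> d" "d + 1 \<le> m" and r: "r > 0"
  shows "crosses r V (d / m)"
proof -
  obtain x y where xy: "x \<in> {0<..<1}" "x < r" "Z x < 0" "y \<in> {0<..<1}" "y < x" "Z y > 0"
    using Z_near_0[OF r] by blast
  have pull: "\<bar>(t + d) / m - d / m\<bar> < r" "(t + d) / m \<in> {0<..<1}" "V ((t + d) / m) = \<alpha> * Z t + \<beta>"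
    if "t \<in> {0<..<1}" "t < r" for t
  proof -
    have mt: "m * ((t + d) / m) - d = t" using m by simp
    then show "V ((t + d) / m) = \<alpha> * Z t + \<beta>" using f(1)[of "(t + d) / m"] that by simp
    show "(t + d) / m \<in> {0<..<1}" using that m by (auto simp: field_simps)
    have "\<bar>(t + d) / m - d / m\<bar> = t / m" using m that by (simp add: add_divide_distrib)
    also have "\<dots> \<le> t / 1" using m that by (intro divide_left_mono) auto
    finally show "\<bar>(t + d) / m - d / m\<bar> < r" using that by simp
  qed
  have vz: "V (d / m) = \<beta>" using f(1)[of "d / m"] m by (simp add: Z_outside)
  show ?thesis
  proof (cases "\<alpha> > 0")
    case True
    then have "\<alpha> * Z x < 0" "0 < \<alpha> * Z y" using xy by (auto simp: mult_pos_neg)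
    then show ?thesis unfolding crosses_def
      by (intro bexI[of _ "(x + d) / m"] bexI[of _ "(y + d) / m"]) (use pull xy vz in auto)
  next
    case False
    then have "\<alpha> * Z y < 0" "0 < \<alpha> * Z x" using xy f(2) by (auto simp: mult_neg_pos mult_neg_neg)
    then show ?thesis unfolding crosses_def
      by (intro bexI[of _ "(y + d) / m"] bexI[of _ "(x + d) / m"]) (use pull xy vz in auto)
  qed
qed

text \<open>Close to 1 the copy supplies only negative values of \<open>Z\<close>; the opposite
  inequality has to come from the ramp after the plateau. Its slope \<sigma> leads to the other side
  exactly when it has the sign of \<alpha>, which is why the copy on the crest, followed by a
  falling ramp, is negated.\<close>

lemma crosses_right_end:
  assumes f: "\<And>t. m * t - d \<in> {0..1} \<Longrightarrow> V t = \<alpha> * Z (m * t - d) + \<beta>"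
    and g: "\<And>t. (d + 1) / m \<le> t \<Longrightarrow> t \<le> b \<Longrightarrow> V t = \<sigma> * t + \<mu>"
    and b: "(d + 1) / m < b" "b \<le> 1" and s: "\<alpha> * \<sigma> > 0"
    and m: "m \<ge> 1" "0 \<le> d" and r: "r > 0"
  shows "crosses r V ((d + 1) / m)"
proof -
  let ?z = "(d + 1) / m"
  have z0: "?z > 0" using m by simp
  obtain x where x: "x \<in> {0<..<1}" "1 - r < x" "Z x < 0" using Z_near_1[OF r] by blast
  define u where "u = (x + d) / m"
  have "0 < min r (b - ?z)" using r b by simp
  then obtain e where "0 < e" "e < min r (b - ?z)" using dense by blast
  then have e: "0 < e" "e < r" "e < b - ?z" by simp_all
  have vz: "V ?z = \<beta>" using f[of ?z] m by (simp add: Z_outside)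
  have vu: "V u = \<beta> + \<alpha> * Z x" using f[of u] m x by (simp add: u_def)
  have ve: "V (?z + e) = \<beta> + \<sigma> * e" using g[of "?z + e"] g[of ?z] vz e b by (simp add: algebra_simps)
  have "?z - u = (1 - x) / m" by (simp add: u_def diff_divide_distrib[symmetric])
  moreover have "(1 - x) / m \<le> (1 - x) / 1" using m x by (intro divide_left_mono) auto
  moreover have "(1 - x) / m > 0" using x m by simp
  ultimately have du: "\<bar>u - ?z\<bar> < r" "u < ?z" using x by auto
  have u0: "u > 0" using x m by (simp add: u_def)
  show ?thesis
  proof (cases "\<alpha> > 0")
    case True
    then have "\<alpha> * Z x < 0" "0 < \<sigma> * e" using x s e by (auto simp: mult_pos_neg zero_less_mult_iff)
    then show ?thesis unfolding crosses_def
      by (intro bexI[of _ u] bexI[of _ "?z + e"]) (use vz vu ve du u0 e b z0 in auto)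
  next
    case False
    then have "\<alpha> * Z x > 0" "0 > \<sigma> * e" using x s e
      by (auto simp: mult_neg_neg zero_less_mult_iff mult_neg_pos)
    then show ?thesis unfolding crosses_def
      by (intro bexI[of _ "?z + e"] bexI[of _ u]) (use vz vu ve du u0 e b z0 in auto)
  qed
qed

text \<open>Ramps and ends of plateaus cross at every scale; the assumption on \<open>Z\<close>
  enters only in the interiors of the crest and the trough.\<close>

lemma step_crosses:
  assumes Q: "\<And>p. p \<in> {0<..<1} \<Longrightarrow> crosses r Z p" and r: "r > 0" and z: "z \<in> {0<..<1}"
  shows "crosses r (step Z k) z"
proof -
  define c where "c = 1 / (real k + 4)"
  have c: "0 < c" "c < 1" by (auto simp: c_def field_simps)
  note sp = step_pieces[where k=k, folded c_def]
  have s: "(1 - c) * c > 0" using c by simp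
  consider "z < 1/8" | "z = 1/8" | "4 * z - 1/2 \<in> {0<..<1}" | "z = 3/8" | "3/8 < z" "z < 5/8"
    | "z = 5/8" | "4 * z - 5/2 \<in> {0<..<1}" | "z = 7/8" | "7/8 < z" by fastforce
  then show ?thesis
  proof cases
    case 1
    show ?thesis by (rule crosses_affine[OF sp(1), of 0 "1/8"]) (use 1 z r c in auto)
  next
    case 2
    have "crosses r (step Z k) ((1/2) / 4)"
      by (rule crosses_left_end[OF sp(2)]) (use r c in auto)
    then show ?thesis unfolding 2 by simp
  next
    case 3
    show ?thesis by (rule crosses_plateau[where f=Z, OF sp(2)]) (use 3 c Q in auto)
  next
    case 4
    have "crosses r (step Z k) ((1/2 + 1) / 4)"
      by (rule crosses_right_end[OF sp(2), of "5/8" "- 8 * (1 - c)" "4 * (1 - c)"])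
        (use r c sp(3) in \<open>auto simp: zero_less_mult_iff mult_less_0_iff\<close>)
    then show ?thesis unfolding 4 by simp
  next
    case 5
    show ?thesis by (rule crosses_affine[OF sp(3), of "3/8" "5/8"]) (use 5 r c in auto)
  next
    case 6
    have "crosses r (step Z k) ((5/2) / 4)"
      by (rule crosses_left_end[OF sp(4)]) (use r c in auto)
    then show ?thesis unfolding 6 by simp
  next
    case 7
    show ?thesis by (rule crosses_plateau[where f=Z, OF sp(4)]) (use 7 c Q in auto)
  next
    case 8
    have "crosses r (step Z k) ((5/2 + 1) / 4)"
      by (rule crosses_right_end[OF sp(4), of 1 "8 * (1 - c)" "- 8 * (1 - c)"])
        (use r c sp(5) in \<open>auto simp: zero_less_mult_iff\<close>)
    then show ?thesis unfolding 8 by simp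
  next
    case 9
    show ?thesis by (rule crosses_affine[OF sp(5), of "7/8" 1]) (use 9 z r c in auto)
  qed
qed

text \<open>The descent in the form of an induction on the scale: \<open>step_crosses\<close> keeps
  the scale and \<open>crosses_cells\<close> halves it. At scale 1 any two points of (0, 1) are
  admissible as witnesses.\<close>

lemma Z_crosses_power: "p \<in> {0<..<1} \<Longrightarrow> crosses ((1/2) ^ n) Z p"
proof (induction n arbitrary: p)
  case 0
  \<comment> \<open>Since the value at \<open>p\<close> is strictly between -1 and 1, some cell has
    an amplitude exceeding its modulus.\<close>
  obtain k :: nat where k: "1 / (1 - \<bar>Z p\<bar>) < real k" using reals_Archimedean2 by blast
  have "1 - \<bar>Z p\<bar> > 0" using Z_abs_less[of p] by simp
  then have "1 < real k * (1 - \<bar>Z p\<bar>)" using k by (simp add: field_simps)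
  also have "\<dots> \<le> (real k + 4) * (1 - \<bar>Z p\<bar>)" using \<open>1 - \<bar>Z p\<bar> > 0\<close> by (intro mult_right_mono) auto
  finally have "1 / (real k + 4) < 1 - \<bar>Z p\<bar>" by (simp add: field_simps)
  then have "Z (cell_point k (3/4)) < Z p" "Z p < Z (cell_point k (1/4))" unfolding Z_quarters by linarith+
  moreover have "cell_point k (1/4) \<in> {0<..<1}" "cell_point k (3/4) \<in> {0<..<1}" using cell_point_pos cell_point_less_1 by auto
  ultimately show ?case unfolding crosses_def
    by (intro bexI[of _ "cell_point k (3/4)"] bexI[of _ "cell_point k (1/4)"]) (use 0 in auto)
next
  case (Suc n)
  have "crosses ((1/2) ^ n / 2) Z p"
  proof (rule crosses_cells[where V = "step Z" and f = Z])
    fix k z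
    define c where "c = 1 / (real k + 4)"
    have c: "0 < c" "c < 1" by (auto simp: c_def field_simps)
    note sp = step_pieces[where k=k, folded c_def]
    show "step Z k 0 < step Z k z" if "0 < z" "z < 1/8"
      using sp(1)[of 0] sp(1)[of z] that c by simp
    show "step Z k z < step Z k 1" if "7/8 < z" "z < 1"
    proof -
      have "(8 * (1 - c)) * z < (8 * (1 - c)) * 1" using that c by (intro mult_strict_left_mono) auto
      then show ?thesis using sp(5)[of 1] sp(5)[of z] that by simp
    qed
    show "crosses ((1/2) ^ n) (step Z k) z" if "z \<in> {0<..<1}"
      using that by (intro step_crosses Suc.IH) auto
  qed (use Z_point Suc.prems in auto)
  then show ?case by (simp add: mult.commute)
qed

lemma Z_crosses: "p \<in> {0<..<1} \<Longrightarrow> r > 0 \<Longrightarrow> crosses r Z p"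
proof -
  assume p: "p \<in> {0<..<1}" and "r > 0"
  then obtain n where n: "(1/2) ^ n < r" using real_arch_pow_inv[of r "1/2"] by auto
  from Z_crosses_power[OF p, of n] obtain x y where xy: "x \<in> {0<..<1}" "y \<in> {0<..<1}"
    "\<bar>x - p\<bar> < (1/2) ^ n" "\<bar>y - p\<bar> < (1/2) ^ n" "Z x < Z p" "Z p < Z y"
    unfolding crosses_def by blast
  then show "crosses r Z p" unfolding crosses_def
    by (intro bexI[of _ x] bexI[of _ y]) (use n in auto)
qed

end

section \<open>Riemann integrability with countably many discontinuities\<close>

text \<open>The sum is the integral of the step function \<open>s n\<close> that takes on each piece
  the value of \<open>f\<close> at its tag. Off a countable set a point lies in one piece only,
  whose tag tends to the point with the mesh, so \<open>s n\<close> tends to \<open>f\<close> by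
  continuity, with \<open>B\<close> as dominating constant.\<close>

lemma riemann_sum_convergence:
  fixes f :: "real \<Rightarrow> real"
  assumes B: "\<And>x. x \<in> {a..b} \<Longrightarrow> \<bar>f x\<bar> \<le> B"
    and N: "countable N" and c: "\<And>x. x \<in> {a..b} - N \<Longrightarrow> isCont f x"
    and D: "\<And>n::nat. \<D> n tagged_division_of {a..b}"
    and mesh: "\<And>n x K. (x, K) \<in> \<D> n \<Longrightarrow> measure lborel K < 1 / (real n + 1)"
  shows "(\<lambda>n. \<Sum>(x, K)\<in>\<D> n. measure lborel K * f x) \<longlonglongrightarrow> integral {a..b} f"
proof -
  define s where "s n x = (\<Sum>(t, K)\<in>\<D> n. f t * indicator K x)" for n x
  \<comment> \<open>Removing the frontiers also removes degenerate pieces and points belonging to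
    two pieces.\<close>
  define E where "E = N \<union> (\<Union>n. \<Union>(t, K)\<in>\<D> n. frontier K)"
  define S where "S = {a..b} - E"
  have fin: "finite (\<D> n)" for n using D by blast
  have box: "\<exists>u v. K = {u..v} \<and> u \<le> v" if "(t, K) \<in> \<D> n" for n t K
    using tagged_division_ofD(2,4)[OF D[of n] that] by fastforce
  have "countable E"
  proof -
    have "countable (frontier K)" if "(t, K) \<in> \<D> n" for n t K
      using box[OF that] by (auto simp: frontier_def)
    then have "countable (\<Union>(t, K)\<in>\<D> n. frontier K)" for n
      using fin[of n] by (intro countable_UN) (auto simp: countable_finite)
    then show ?thesis unfolding E_def using N by blast
  qed
  then have "negligible (\<Union>x\<in>E. {x})" by (intro negligible_countable_Union) auto
  then have negE: "negligible E" by simp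
  have spike: "(g has_integral i) S \<longleftrightarrow> (g has_integral i) {a..b}" for g :: "real \<Rightarrow> real" and i
    by (rule has_integral_spike_set_eq; rule negligible_subset[OF negE]) (auto simp: S_def)
  have sI: "(s n has_integral (\<Sum>(x, K)\<in>\<D> n. measure lborel K * f x)) {a..b}" for n
    unfolding s_def
  proof (rule has_integral_sum[OF fin], clarify)
    fix t K assume tK: "(t, K) \<in> \<D> n"
    obtain u v where K: "K = {u..v}" "u \<le> v" using box[OF tK] by blast
    have "K \<subseteq> {a..b}" using tagged_division_ofD(3)[OF D tK] .
    have "((\<lambda>x. f t) has_integral (measure lborel K * f t)) K"
      using has_integral_const_real[of "f t" u v] K by simp
    then have "((\<lambda>x. if x \<in> K then f t else 0) has_integral (measure lborel K * f t)) {a..b}"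
      by (subst has_integral_restrict[OF \<open>K \<subseteq> {a..b}\<close>])
    moreover have "(\<lambda>x. if x \<in> K then f t else 0) = (\<lambda>x. f t * indicator K x)"
      by (auto simp: indicator_def)
    ultimately show "((\<lambda>x. f t * indicator K x) has_integral (measure lborel K * f t)) {a..b}" by simp
  qed
  have val: "\<exists>t\<in>{a..b}. s n x = f t \<and> \<bar>t - x\<bar> < 1 / (real n + 1)" if x: "x \<in> S" for n x
  proof -
    have "x \<in> \<Union>{K. \<exists>t. (t, K) \<in> \<D> n}"
      using tagged_division_ofD(6)[OF D[of n]] x by (auto simp: S_def)
    then obtain t K where tK: "(t, K) \<in> \<D> n" "x \<in> K" by blast
    have int: "x \<in> interior L" if "(u, L) \<in> \<D> n" "x \<in> L" for u L
    proof -
      have "x \<notin> frontier L" using x that by (auto simp: S_def E_def)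
      then show ?thesis using that closure_subset by (auto simp: frontier_def)
    qed
    have only: "(u, L) = (t, K)" if "(u, L) \<in> \<D> n" "x \<in> L" for u L
      using tagged_division_ofD(5)[OF D that(1) tK(1)] int[OF that] int[OF tK] by blast
    have "s n x = (\<Sum>p\<in>\<D> n. if p = (t, K) then f t else 0)"
      unfolding s_def
    proof (rule sum.cong)
      fix p assume p: "p \<in> \<D> n"
      obtain u L where uL: "p = (u, L)" by (cases p)
      show "(case p of (t, K) \<Rightarrow> f t * indicator K x) = (if p = (t, K) then f t else 0)"
      proof (cases "x \<in> L")
        case True
        then have "p = (t, K)" using only p uL by simp
        then show ?thesis using tK(2) by simp
      next
        case False
        then have "p \<noteq> (t, K)" using uL tK(2) by blast
        then have "(if p = (t, K) then f t else 0) = 0" by (rule if_not_P)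
        moreover have "(case p of (t, K) \<Rightarrow> f t * indicator K x) = 0" using False uL by simp
        ultimately show ?thesis by (simp only:)
      qed
    qed simp
    then have "s n x = f t" using fin tK by simp
    moreover have "t \<in> K" "K \<subseteq> {a..b}"
      using tagged_division_ofD(2,3)[OF D tK(1)] by auto
    moreover obtain u v where K: "K = {u..v}" "u \<le> v" using box[OF tK(1)] by blast
    moreover have "v - u < 1 / (real n + 1)" using mesh[OF tK(1)] K by simp
    ultimately show ?thesis using tK(2) by (intro bexI[of _ t]) auto
  qed
  have "(\<lambda>n. integral S (s n)) \<longlonglongrightarrow> integral S f"
  proof (rule dominated_convergence(2)[where h="\<lambda>_. B"])
    show "s n integrable_on S" for n using sI spike by blast
    show "(\<lambda>_. B) integrable_on S" using spike integrable_const_ivl[of B a b] by (metis integrable_on_def)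
    show "norm (s n x) \<le> B" if "x \<in> S" for n x using val[OF that, of n] B by auto
    show "(\<lambda>n. s n x) \<longlonglongrightarrow> f x" if x: "x \<in> S" for x
    proof -
      obtain t where t: "\<And>n. s n x = f (t n)" "\<And>n. \<bar>t n - x\<bar> < 1 / (real n + 1)"
        using val[OF x] by metis
      have "(\<lambda>n. t n - x) \<longlonglongrightarrow> 0"
      proof (rule Lim_null_comparison)
        show "\<forall>\<^sub>F n in sequentially. norm (t n - x) \<le> inverse (real (Suc n))"
          using t(2) by (intro always_eventually allI) (simp add: inverse_eq_divide less_imp_le add.commute)
      qed (rule LIMSEQ_inverse_real_of_nat)
      then have "t \<longlonglongrightarrow> x" by (simp add: LIM_zero_iff)
      moreover have "isCont f x" using x c by (auto simp: S_def E_def)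
      ultimately show ?thesis unfolding t(1) by (rule isCont_tendsto_compose[rotated])
    qed
  qed
  moreover have "integral S (s n) = (\<Sum>(x, K)\<in>\<D> n. measure lborel K * f x)" for n
    using sI spike by (blast intro: integral_unique)
  moreover have "integral S f = integral {a..b} f"
    using spike unfolding integral_def integrable_on_def by simp
  ultimately show ?thesis by simp
qed

lemma riemann_integrable_countable_discontinuities:
  fixes f :: "real \<Rightarrow> real"
  assumes "\<And>x. x \<in> {a..b} \<Longrightarrow> \<bar>f x\<bar> \<le> B" "countable {x. \<not> isCont f x}"
  shows "riemann_integrable_on f a b"
  unfolding riemann_integrable_on_def
proof (rule exI[of _ "integral {a..b} f"], intro allI impI)
  fix e :: real assume e: "e > 0"
  let ?R = "\<lambda>\<D>. \<Sum>(x, K)\<in>\<D>. measure lborel K * f x"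
  show "\<exists>\<delta>>0. \<forall>\<D>. \<D> tagged_division_of {a..b} \<and> (\<forall>(x, K)\<in>\<D>. measure lborel K < \<delta>) \<longrightarrow>
    \<bar>?R \<D> - integral {a..b} f\<bar> < e"
  proof (rule ccontr)
    assume "\<not> ?thesis"
    \<comment> \<open>A failure for \<open>e\<close> is sampled along the meshes
      \<open>1 / (n + 1)\<close>, which gives a sequence contradicting the preceding lemma.\<close>
    then have "\<forall>n::nat. \<exists>\<D>. \<D> tagged_division_of {a..b} \<and>
      (\<forall>(x, K)\<in>\<D>. measure lborel K < 1 / (real n + 1)) \<and> \<not> \<bar>?R \<D> - integral {a..b} f\<bar> < e"
      by (metis of_nat_0_le_iff add_nonneg_pos zero_less_one divide_pos_pos)
    then obtain \<D> where \<D>: "\<And>n::nat. \<D> n tagged_division_of {a..b}"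
      "\<And>n. \<forall>(x, K)\<in>\<D> n. measure lborel K < 1 / (real n + 1)"
      "\<And>n. \<not> \<bar>?R (\<D> n) - integral {a..b} f\<bar> < e"
      by metis
    have "(\<lambda>n. ?R (\<D> n)) \<longlonglongrightarrow> integral {a..b} f"
      by (rule riemann_sum_convergence[where N="{x. \<not> isCont f x}" and B=B]) (use assms \<D> in fastforce)+
    then have "\<forall>\<^sub>F n in sequentially. dist (?R (\<D> n)) (integral {a..b} f) < e"
      using e by (rule tendstoD)
    then show False using \<D>(3) by (auto simp: dist_real_def eventually_sequentially)
  qed
qed

section \<open>Convexity and monotonicity of the derivative\<close>

text \<open>A convex function lies above its tangents; adding the tangent inequalities at the two
  points gives the claim.\<close>

lemma strictly_convex_deriv_mono:
  assumes s: "strictly_convex_on S f" and xy: "x < y" "x \<in> interior S" "y \<in> interior S"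
    and d: "(f has_real_derivative f' x) (at x)" "(f has_real_derivative f' y) (at y)"
  shows "f' x \<le> f' y"
proof -
  have S: "convex S" using s by (simp add: strictly_convex_on_def)
  have c: "convex_on S f"
  proof (rule convex_onI[OF _ S])
    fix t u v :: real assume t: "0 < t" "t < 1" "u \<in> S" "v \<in> S"
    show "f ((1 - t) *\<^sub>R u + t *\<^sub>R v) \<le> (1 - t) * f u + t * f v"
    proof (cases "u = v")
      case True then show ?thesis by (simp add: algebra_simps)
    next
      case False
      have "f ((1 - t) * u + t * v) < (1 - t) * f u + t * f v"
        using s t False unfolding strictly_convex_on_def by simp
      then show ?thesis by simp
    qed
  qed
  have "f y - f x \<ge> f' x * (y - x)"
    by (rule convex_on_imp_above_tangent[OF c convex_connected[OF S]])
      (use xy d interior_subset in \<open>auto intro: has_field_derivative_at_within\<close>)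
  moreover have "f x - f y \<ge> f' y * (x - y)"
    by (rule convex_on_imp_above_tangent[OF c convex_connected[OF S]])
      (use xy d interior_subset in \<open>auto intro: has_field_derivative_at_within\<close>)
  ultimately have "f' x * (y - x) \<le> f' y * (y - x)" by (simp add: algebra_simps)
  then show ?thesis using xy(1) by simp
qed

section \<open>The counterexample\<close>

text \<open>
  Added to the identity, it produces a plateau on \<open>[1/4, 3/4]\<close>.
\<close>

definition hat :: "real \<Rightarrow> real" where
  "hat z = max 0 (1/4 - \<bar>z - 1/4\<bar>) - max 0 (1/4 - \<bar>z - 3/4\<bar>)"

lemma hat_supported: "\<exists>T. supported_derivative hat T"
proof (rule supported_derivative_odd)
  show "continuous_on UNIV hat" unfolding hat_def by (intro continuous_intros)
qed (auto simp: hat_def max_def abs_if)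

text \<open>The factor is the width of the cell and hence the slope of the identity in cell
  coordinates, so \<open>hat\<close> flattens the identity exactly. The copy of \<open>Z\<close>
  occupies the resulting plateau, since \<open>2 * z - 1/2\<close> maps [1/4, 3/4] onto
  [0, 1].\<close>

definition perturbation :: "(real \<Rightarrow> real) \<Rightarrow> nat \<Rightarrow> real \<Rightarrow> real" where
  "perturbation Z k z = (1 / ((real k + 1) * (real k + 2))) * (hat z + Z (2 * z - 1/2))"

definition counterexample :: "(real \<Rightarrow> real) \<Rightarrow> real \<Rightarrow> real" where
  "counterexample Z x = \<bar>x\<bar> + cells (perturbation Z) x"

lemma half_square_deriv: "((\<lambda>x::real. x * \<bar>x\<bar> / 2) has_real_derivative \<bar>x\<bar>) (at x)"
proof -
  consider "x < 0" | "x = 0" | "x > 0" by linarith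
  then show ?thesis
  proof cases
    case 1
    have "((\<lambda>x. - x * x / 2) has_real_derivative \<bar>x\<bar>) (at x)"
      using 1 by (auto intro!: derivative_eq_intros)
    then show ?thesis
      by (rule has_field_derivative_transform_within_open[of _ _ _ "{..<0}"]) (use 1 in auto)
  next
    case 2
    have "((\<lambda>h::real. \<bar>h\<bar> / 2) \<longlongrightarrow> 0) (at 0)" by (auto intro!: tendsto_eq_intros)
    then have "((\<lambda>h::real. (h * \<bar>h\<bar> / 2) / h) \<longlongrightarrow> 0) (at 0)"
      by (rule Lim_transform_eventually) (auto simp: eventually_at_filter)
    with 2 show ?thesis by (simp add: DERIV_def)
  next
    case 3
    have "((\<lambda>x. x * x / 2) has_real_derivative \<bar>x\<bar>) (at x)"
      using 3 by (auto intro!: derivative_eq_intros)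
    then show ?thesis
      by (rule has_field_derivative_transform_within_open[of _ _ _ "{0<..}"]) (use 3 in auto)
  qed
qed

lemma counterexample_deriv:
  assumes Z: "self_similar Z" "supported_derivative Z F"
  obtains G where "\<And>x. (G has_real_derivative counterexample Z x) (at x)"
    "countable {x. \<not> isCont (counterexample Z) x}" "\<And>x. \<bar>counterexample Z x\<bar> \<le> \<bar>x\<bar> + 2"
    "\<And>x. x \<le> 0 \<Longrightarrow> counterexample Z x = - x"
    "\<And>k z. z \<in> {0..1} \<Longrightarrow> counterexample Z (cell_point k z) = cell_point k z + perturbation Z k z"
proof -
  obtain T where T: "supported_derivative hat T" using hat_supported ..
  have a: "supported_derivative (\<lambda>x. Z (2 * x - 1/2)) (\<lambda>x. F (2 * x - 1/2) / 2)"
    by (rule supported_derivative_rescale[OF Z(2)]; simp)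
  have "perturbation Z k = (\<lambda>z. (1 / ((real k + 1) * (real k + 2))) * hat z
      + (1 / ((real k + 1) * (real k + 2))) * Z (2 * z - 1/2))" for k
    unfolding perturbation_def by (rule ext) (simp only: distrib_left)
  then have "\<exists>W. supported_derivative (perturbation Z k) W" for k
    using supported_derivative_linear[OF T a, of "1 / ((real k + 1) * (real k + 2))" "1 / ((real k + 1) * (real k + 2))"]
    by auto
  then obtain W where W: "\<And>k. supported_derivative (perturbation Z k) (W k)" by metis
  have W0: "z \<notin> {0<..<1} \<Longrightarrow> perturbation Z k z = 0" for k z
    using W by (simp add: supported_derivative_def)
  have B: "\<bar>perturbation Z k z\<bar> \<le> 2" for k z
  proof -
    have "\<bar>hat z\<bar> \<le> 1" by (auto simp: hat_def max_def abs_if)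
    moreover have "\<bar>Z (2 * z - 1/2)\<bar> \<le> 1" using Z(1) by (simp add: self_similar_def)
    ultimately have 1: "\<bar>hat z + Z (2 * z - 1/2)\<bar> \<le> 2" by linarith
    have "1 * 1 \<le> (real k + 1) * (real k + 2)" by (intro mult_mono) auto
    then have "\<bar>1 / ((real k + 1) * (real k + 2))\<bar> \<le> 1" by simp
    from mult_mono[OF this 1] show ?thesis unfolding perturbation_def abs_mult by simp
  qed
  define P where "P = cells (\<lambda>k z. W k z / ((real k + 1) * (real k + 2)))"
  have P: "supported_derivative (cells (perturbation Z)) P"
    unfolding P_def by (rule supported_derivative_cells[where w="perturbation Z", OF W B])
  show ?thesis
  proof (rule that[of "\<lambda>x. x * \<bar>x\<bar> / 2 + P x"])
    show "((\<lambda>x. x * \<bar>x\<bar> / 2 + P x) has_real_derivative counterexample Z x) (at x)" for x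
      unfolding counterexample_def
      using P by (intro DERIV_add half_square_deriv) (simp add: supported_derivative_def)
    have "{x. \<not> isCont (counterexample Z) x} \<subseteq> {x. \<not> isCont (cells (perturbation Z)) x}"
      unfolding counterexample_def by (auto intro!: continuous_intros)
    then show "countable {x. \<not> isCont (counterexample Z) x}"
      using P by (auto simp: supported_derivative_def intro: countable_subset)
    have "\<bar>cells (perturbation Z) x\<bar> \<le> 2" for x by (rule cells_abs_le) (use W0 B in auto)
    then show "\<bar>counterexample Z x\<bar> \<le> \<bar>x\<bar> + 2" for x
      unfolding counterexample_def by (smt (verit))
    show "x \<le> 0 \<Longrightarrow> counterexample Z x = - x" for x
      by (simp add: counterexample_def cells_nonpos)
    show "counterexample Z (cell_point k z) = cell_point k z + perturbation Z k z" if z: "z \<in> {0..1}" for k z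
    proof -
      have "cells (perturbation Z) (cell_point k z) = perturbation Z k z"
        using W0 z by (intro cells_point)
      moreover have "cell_point k z > 0" using z by (intro cell_point_pos) simp
      ultimately show ?thesis by (simp add: counterexample_def)
    qed
  qed
qed

text \<open>In cell coordinates the identity is \<open>w k * (real k + 1 + z)\<close>. The two ramps
  have twice its slope, which makes up for the plateau at the midpoint height.\<close>

lemma staircase_pieces:
  assumes Z: "self_similar Z"
  defines "w \<equiv> \<lambda>k::nat. 1 / ((real k + 1) * (real k + 2))"
  shows "0 \<le> z \<Longrightarrow> z \<le> 1/4 \<Longrightarrow> cell_point k z + perturbation Z k z = 2 * w k * z + (real k + 1) * w k"
    and "2 * z - 1/2 \<in> {0..1} \<Longrightarrow>
      cell_point k z + perturbation Z k z = w k * Z (2 * z - 1/2) + (real k + 3/2) * w k"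
    and "3/4 \<le> z \<Longrightarrow> z \<le> 1 \<Longrightarrow> cell_point k z + perturbation Z k z = 2 * w k * z + real k * w k"
proof -
  have j: "real k + 1 > 0" "real k + 2 > 0" by linarith+
  have p: "cell_point k z = w k * (real k + 1 + z)"
    unfolding cell_point_def w_def using j by (simp add: divide_simps)
  have "perturbation Z k z = w k * (hat z + Z (2 * z - 1/2))"
    by (simp add: perturbation_def w_def)
  with p have e: "cell_point k z + perturbation Z k z = w k * (real k + 1 + z + hat z + Z (2 * z - 1/2))"
    by (simp add: algebra_simps)
  show "cell_point k z + perturbation Z k z = 2 * w k * z + (real k + 1) * w k" if "0 \<le> z" "z \<le> 1/4"
  proof -
    have "hat z = z" using that by (auto simp: hat_def max_def abs_if)
    then show ?thesis unfolding e using that Z_outside[OF Z, of "2 * z - 1/2"] by (simp add: algebra_simps)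
  qed
  show "cell_point k z + perturbation Z k z = w k * Z (2 * z - 1/2) + (real k + 3/2) * w k"
    if "2 * z - 1/2 \<in> {0..1}"
  proof -
    have h: "hat z = 1/2 - z" using that by (auto simp: hat_def max_def abs_if)
    show ?thesis unfolding e h by (simp add: algebra_simps)
  qed
  show "cell_point k z + perturbation Z k z = 2 * w k * z + real k * w k" if "3/4 \<le> z" "z \<le> 1"
  proof -
    have h: "hat z = z - 1" using that by (auto simp: hat_def max_def abs_if)
    show ?thesis unfolding e h using that Z_outside[OF Z, of "2 * z - 1/2"] by (simp add: algebra_simps)
  qed
qed

text \<open>The plateau is followed by a rising ramp and carries a positive multiple of
  \<open>Z\<close>, so the sign condition at its right end holds. On its interior \<open>Z\<close>
  already crosses at every scale.\<close>

lemma staircase_crosses: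
  assumes Z: "self_similar Z" and z: "z \<in> {0<..<1}" and r: "r > 0"
  shows "crosses r (\<lambda>z. cell_point k z + perturbation Z k z) z"
proof -
  define w where "w = 1 / ((real k + 1) * (real k + 2))"
  have w: "w > 0" by (simp add: w_def)
  note sp = staircase_pieces[OF Z, where k=k, folded w_def]
  let ?V = "\<lambda>z. cell_point k z + perturbation Z k z"
  consider "z < 1/4" | "z = 1/4" | "2 * z - 1/2 \<in> {0<..<1}" | "z = 3/4" | "3/4 < z" by fastforce
  then show ?thesis
  proof cases
    case 1
    show ?thesis
      by (rule crosses_affine[of 0 "1/4" _ "2 * w" "(real k + 1) * w"]) (use sp(1) 1 z r w in auto)
  next
    case 2
    have "crosses r ?V ((1/2) / 2)"
      by (rule crosses_left_end[OF Z, of _ _ _ w "(real k + 3/2) * w"]) (use sp(2) r w in auto)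
    then show ?thesis unfolding 2 by simp
  next
    case 3
    show ?thesis
      by (rule crosses_plateau[of 2 "1/2" _ w Z "(real k + 3/2) * w"])
        (use sp(2) 3 w Z_crosses[OF Z] r in auto)
  next
    case 4
    have "crosses r ?V ((1/2 + 1) / 2)"
      by (rule crosses_right_end[OF Z, of _ _ _ w "(real k + 3/2) * w" 1 "2 * w" "real k * w"])
        (use sp(2,3) r w in auto)
    then show ?thesis unfolding 4 by simp
  next
    case 5
    show ?thesis
      by (rule crosses_affine[of "3/4" 1 _ "2 * w" "real k * w"]) (use sp(3) 5 z r w in auto)
  qed
qed

theorem mainTheorem2:
  shows "\<exists>(a::real) (b::real) (G :: real \<Rightarrow> real) (g :: real \<Rightarrow> real) (x0::real).
    a < b \<and>
    (\<forall>x\<in>{a..b}. (G has_real_derivative g x) (at x within {a..b})) \<and>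
    x0 \<in> {a<..<b} \<and>
    riemann_integrable_on g a b \<and>
    isolated_local_extremum_on {a..b} g x0 \<and>
    \<not> inflection_point_on {a..b} G x0"
proof -
  obtain Z F where Z: "self_similar Z" "supported_derivative Z F" using self_similar_exists by blast
  define g where "g = counterexample Z"
  from counterexample_deriv[OF Z] obtain G where G: "\<And>x. (G has_real_derivative g x) (at x)"
    and gc: "countable {x. \<not> isCont g x}" and gB: "\<And>x. \<bar>g x\<bar> \<le> \<bar>x\<bar> + 2"
    and gn: "\<And>x. x \<le> 0 \<Longrightarrow> g x = - x"
    and gp: "\<And>k z. z \<in> {0..1} \<Longrightarrow> g (cell_point k z) = cell_point k z + perturbation Z k z"
    unfolding g_def by blast
  have cross: "crosses r g p" if p: "p \<in> {0<..<1}" and r: "r > 0" for p r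
  proof -
    \<comment> \<open>The factor 2 offsets the halving in \<open>crosses_cells\<close>.\<close>
    have "crosses (2 * r / 2) g p"
    proof (rule crosses_cells[where V = "\<lambda>k z. cell_point k z + perturbation Z k z"])
      fix k z
      define w where "w = 1 / ((real k + 1) * (real k + 2))"
      have w: "w > 0" by (simp add: w_def)
      note sp = staircase_pieces[OF Z(1), where k=k, folded w_def]
      show "cell_point k 0 + perturbation Z k 0 < cell_point k z + perturbation Z k z" if "0 < z" "z < 1/8"
        using sp(1)[of 0] sp(1)[of z] that w by simp
      show "cell_point k z + perturbation Z k z < cell_point k 1 + perturbation Z k 1" if "7/8 < z" "z < 1"
        using sp(3)[of 1] sp(3)[of z] that w by simp
      show "crosses (2 * r) (\<lambda>z. cell_point k z + perturbation Z k z) z" if "z \<in> {0<..<1}"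
        using that r by (intro staircase_crosses Z) auto
    qed (use gp p r in auto)
    then show ?thesis by simp
  qed
  have pos: "g x \<ge> 0" if "x \<in> {-1..1}" for x
  proof (cases "x \<in> {0<..<1}")
    case True
    obtain k z where kz: "0 < z" "z \<le> 1" "x = cell_point k z" using True by (auto elim: cell_point_cases)
    define w where "w = 1 / ((real k + 1) * (real k + 2))"
    have w: "w > 0" by (simp add: w_def)
    note sp = staircase_pieces[OF Z(1), where k=k, folded w_def]
    consider "z \<le> 1/4" | "2 * z - 1/2 \<in> {0..1}" | "3/4 \<le> z" by fastforce
    then show ?thesis
    proof cases
      case 2
      \<comment> \<open>The copy lowers the plateau by at most \<open>w\<close>, and the plateau has
        height at least \<open>w\<close>.\<close>
      have "w * Z (2 * z - 1/2) \<ge> w * (-1)"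
        using w Z_abs_less[OF Z(1), of "2 * z - 1/2"] by (intro mult_left_mono) auto
      moreover have "(real k + 3/2) * w \<ge> 1 * w" using w by (intro mult_right_mono) auto
      ultimately show ?thesis using gp[of z k] sp(2)[of z] 2 kz by simp
    qed (use gp[of z k] sp(1)[of z] sp(3)[of z] kz w in auto)
  next
    case False
    have "x \<le> 0 \<or> x = cell_point 0 1" using False that by (auto simp: cell_point_1)
    then consider "x \<le> 0" | "x = cell_point 0 1" by blast
    then show ?thesis
    proof cases
      case 1 then show ?thesis using gn by simp
    next
      case 2 then show ?thesis using gp[of 1 0] staircase_pieces(3)[OF Z(1), of 1 0] by simp
    qed
  qed
  have iso: "\<not> local_extremum_on {-1..1} g p" if p: "p \<in> {-1<..<1}" "p \<noteq> 0" for p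
  proof
    assume "local_extremum_on {-1..1} g p"
    then obtain U where U: "open U" "p \<in> U"
      "(\<forall>x\<in>U \<inter> {-1..1}. g x \<le> g p) \<or> (\<forall>x\<in>U \<inter> {-1..1}. g p \<le> g x)"
      unfolding local_extremum_on_def local_max_on_def local_min_on_def by blast
    obtain r where r: "r > 0" "ball p r \<subseteq> U" using U open_contains_ball by blast
    have "\<exists>x y. x \<in> {-1..1} \<and> y \<in> {-1..1} \<and> \<bar>x - p\<bar> < r \<and> \<bar>y - p\<bar> < r \<and> g x < g p \<and> g p < g y"
    proof (cases "p > 0")
      case True
      then have "crosses r g p" using cross p r by simp
      then obtain x y where xy: "x \<in> {0<..<1}" "y \<in> {0<..<1}" "\<bar>x - p\<bar> < r" "\<bar>y - p\<bar> < r"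
        "g x < g p" "g p < g y" unfolding crosses_def by blast
      then show ?thesis by (intro exI[of _ x] exI[of _ y]) auto
    next
      case False
      \<comment> \<open>The last two bounds keep both witnesses between -1 and 0, where
        \<open>g\<close> is strictly decreasing.\<close>
      have "0 < min r (min (p + 1) (- p))" using p r False by simp
      then obtain e where "0 < e" "e < min r (min (p + 1) (- p))" using dense by blast
      then have e: "0 < e" "e < r" "e < p + 1" "e < - p" by simp_all
      show ?thesis by (intro exI[of _ "p + e"] exI[of _ "p - e"]) (use e gn p in auto)
    qed
    then obtain x y where xy: "x \<in> {-1..1}" "y \<in> {-1..1}" "\<bar>x - p\<bar> < r" "\<bar>y - p\<bar> < r"
      "g x < g p" "g p < g y" by blast
    then have "x \<in> U" "y \<in> U" using r(2) by (auto simp: subset_iff dist_real_def abs_minus_commute)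
    with U(3) xy show False by (meson IntI leD)
  qed
  have ext: "isolated_local_extremum_on {-1..1} g 0"
    unfolding isolated_local_extremum_on_def
  proof
    have "local_min_on {-1..1} g 0" unfolding local_min_on_def
      using pos gn[of 0] by (auto intro!: exI[of _ UNIV])
    then show "local_extremum_on {-1..1} g 0" by (simp add: local_extremum_on_def)
    show "\<exists>U. open U \<and> 0 \<in> U \<and> (\<forall>x\<in>U. local_extremum_on {-1..1} g x \<longrightarrow> x = 0)"
      using iso by (intro exI[of _ "{-1<..<1}"]) (meson greaterThanLessThan_iff less_minus_one_simps(1)
        open_greaterThanLessThan zero_less_one)
  qed
  have infl: "\<not> inflection_point_on {-1..1} G 0"
  proof
    assume "inflection_point_on {-1..1} G 0"
    \<comment> \<open>Both alternatives include strict convexity on one side, which would make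
      \<open>g\<close> nondecreasing there.\<close>
    then obtain e where e: "e > 0"
      "strictly_convex_on {0 - e<..0} G \<or> strictly_convex_on {0..<0 + e} G"
      unfolding inflection_point_on_def by blast
    from e(2) show False
    proof
      assume s: "strictly_convex_on {0 - e<..0} G"
      have "interior {0 - e<..0} = {-e<..<0}" by simp
      then have "g (- e / 2) \<le> g (- e / 3)"
        using e(1) by (intro strictly_convex_deriv_mono[OF s _ _ _ G G]) auto
      then show False using gn[of "- e / 2"] gn[of "- e / 3"] e(1) by simp
    next
      assume s: "strictly_convex_on {0..<0 + e} G"
      obtain x y where xy: "x \<in> {0<..<1}" "Z x < 0" "y \<in> {0<..<1}" "y < x" "Z y > 0"
        using Z_near_0[OF Z(1), of 1] by auto
      \<comment> \<open>Cell \<open>k\<close> lies to the left of \<open>e\<close>; the positive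
        value of its copy of \<open>Z\<close> precedes the negative one, so \<open>g\<close>
        decreases between them.\<close>
      obtain k :: nat where k: "1 / e < real k" using reals_Archimedean2 by blast
      define w where "w = 1 / ((real k + 1) * (real k + 2))"
      have w: "w > 0" by (simp add: w_def)
      note sp = staircase_pieces[OF Z(1), where k=k, folded w_def]
      \<comment> \<open>The point \<open>(t + 1/2) / 2\<close> of the plateau is the one that
        corresponds to \<open>t\<close> in the copy of \<open>Z\<close>.\<close>
      have val: "g (cell_point k ((t + 1/2) / 2)) = w * Z t + (real k + 3/2) * w" if "t \<in> {0<..<1}" for t
      proof -
        have "2 * ((t + 1/2) / 2) - 1/2 = t" by (simp add: field_simps)
        then show ?thesis using gp[of "(t + 1/2) / 2" k] sp(2)[of "(t + 1/2) / 2"] that by simp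
      qed
      have "1 < real k * e" using k e(1) by (simp add: field_simps)
      then have "1 / (real k + 1) < e" using e(1) by (simp add: field_simps)
      moreover note cell_point_1[of k]
      moreover have "cell_point k ((t + 1/2) / 2) < cell_point k 1" if "t \<in> {0<..<1}" for t
        using that by (simp add: cell_point_less_iff)
      ultimately have ran: "cell_point k ((t + 1/2) / 2) \<in> interior {0..<0 + e}" if "t \<in> {0<..<1}" for t
        using that cell_point_pos[of "(t + 1/2) / 2" k] by fastforce
      have "g (cell_point k ((y + 1/2) / 2)) \<le> g (cell_point k ((x + 1/2) / 2))"
        by (rule strictly_convex_deriv_mono[OF s _ _ _ G G]) (use ran xy in \<open>auto simp: cell_point_less_iff\<close>)
      then have "w * Z y \<le> w * Z x" using val xy by simp
      then show False using w xy by (simp add: mult_le_cancel_left_pos)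
    qed
  qed
  have "riemann_integrable_on g (-1) 1"
  proof (rule riemann_integrable_countable_discontinuities[OF _ gc])
    show "\<bar>g x\<bar> \<le> 3" if "x \<in> {-1..1}" for x using gB[of x] that by auto
  qed
  then show ?thesis
    by (intro exI[of _ "-1"] exI[of _ 1] exI[of _ G] exI[of _ g] exI[of _ 0])
      (use G ext infl in \<open>auto intro: has_field_derivative_at_within\<close>)
qed

end
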